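(* Let $\mathbb B_n$ be the unit ball of $\mathbb C^n$ and let $\psi\in C^{1,1}(\overline{\mathbb B}_n)$. Then $P(\psi)\in C^{1,1}(\mathbb B_n)$.
   Context: $P(\psi)=\left(\sup\{v\in\mathcal{PSH}(\mathbb B_n): v\le\psi \text{ on } \mathbb B_n\}\right)^*$ is the psh envelope of $\psi$ in $\mathbb B_n$, where $\mathcal{PSH}(\mathbb B_n)$ is the set of plurisubharmonic functions on $\mathbb B_n$ and $^*$ denotes upper semicontinuous regularization (not needed when $\psi$ is upper semicontinuous). $C^{1,1}(\mathbb B_n)$ is understood locally: $C^{1,1}$-regularity on every $\Omega'\Subset\mathbb B_n$. The function $\psi$ is real-valued and not assumed plurisubharmonic. *)

theory Defs
  imports "HOL-Analysis.Analysis"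
begin

definition usc_on :: "'a::topological_space set \<Rightarrow> ('a \<Rightarrow> ereal) \<Rightarrow> bool" where
  "usc_on S u \<longleftrightarrow> (\<forall>c. openin (top_of_set S) {x \<in> S. u x < c})"

text \<open>The upper limit includes the value at the point itself, since the filter
  \<open>inf (nhds x) (principal S)\<close> is not punctured (unlike \<open>at x within S\<close>).\<close>

definition usc_regularization :: "'a::topological_space set \<Rightarrow> ('a \<Rightarrow> ereal) \<Rightarrow> 'a \<Rightarrow> ereal" where
  "usc_regularization S u x = Limsup (inf (nhds x) (principal S)) u"

text \<open>The mean of \<open>u\<close> over a circle, as the integral of the positive part minus that of the
  negative part (\<open>e2ennreal\<close> maps negative numbers to 0). For an upper semicontinuous \<open>u < \<infinity>\<close>
  the first integral is finite, so the difference is meaningful, possibly \<open>-\<infinity>\<close>.\<close>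

definition circle_mean :: "(complex \<Rightarrow> ereal) \<Rightarrow> complex \<Rightarrow> real \<Rightarrow> ereal" where
  "circle_mean u a r =
    (enn2ereal (\<integral>\<^sup>+ t \<in> {0..2*pi}. e2ennreal (u (a + of_real r * cis t)) \<partial>lborel)
     - enn2ereal (\<integral>\<^sup>+ t \<in> {0..2*pi}. e2ennreal (- u (a + of_real r * cis t)) \<partial>lborel))
    / ereal (2 * pi)"

text \<open>Here \<open>-\<infinity>\<close> on whole components is allowed, as is needed for restrictions of
  plurisubharmonic functions to complex lines.\<close>

definition subharmonic_on :: "complex set \<Rightarrow> (complex \<Rightarrow> ereal) \<Rightarrow> bool" where
  "subharmonic_on U u \<longleftrightarrow>
    usc_on U u \<and> (\<forall>a\<in>U. u a < \<infinity>) \<and>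
    (\<forall>a r. 0 < r \<and> cball a r \<subseteq> U \<longrightarrow> u a \<le> circle_mean u a r)"

definition PSH :: "(complex ^ 'n) set \<Rightarrow> (complex ^ 'n \<Rightarrow> ereal) set" where
  "PSH \<Omega> = {u. usc_on \<Omega> u \<and> (\<forall>z\<in>\<Omega>. u z < \<infinity>) \<and>
      (\<forall>C\<in>components \<Omega>. \<exists>z\<in>C. u z \<noteq> -\<infinity>) \<and>
      (\<forall>a w. subharmonic_on {\<zeta>. a + \<zeta> *s w \<in> \<Omega>} (\<lambda>\<zeta>. u (a + \<zeta> *s w)))}"

definition psh_envelope :: "(complex ^ 'n) set \<Rightarrow> (complex ^ 'n \<Rightarrow> real) \<Rightarrow> complex ^ 'n \<Rightarrow> ereal" where
  "psh_envelope \<Omega> \<psi> =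
    usc_regularization \<Omega> (\<lambda>z. SUP v\<in>{v \<in> PSH \<Omega>. \<forall>x\<in>\<Omega>. v x \<le> ereal (\<psi> x)}. v z)"

text \<open>\<open>C\<^sup>1\<^sup>,\<^sup>1\<close> up to the boundary of a bounded open set \<open>\<Omega>\<close>: the real Frechet derivative on \<open>\<Omega>\<close>
  extends to a Lipschitz map on the closure.\<close>

definition C11_closure :: "'a::real_normed_vector set \<Rightarrow> ('a \<Rightarrow> real) \<Rightarrow> bool" where
  "C11_closure \<Omega> f \<longleftrightarrow> continuous_on (closure \<Omega>) f \<and>
    (\<exists>(D :: 'a \<Rightarrow> 'a \<Rightarrow>\<^sub>L real) L.
      (\<forall>x\<in>\<Omega>. (f has_derivative blinfun_apply (D x)) (at x)) \<and> L-lipschitz_on (closure \<Omega>) D)"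

definition C11_loc :: "'a::real_normed_vector set \<Rightarrow> ('a \<Rightarrow> real) \<Rightarrow> bool" where
  "C11_loc \<Omega> f \<longleftrightarrow>
    (\<forall>\<Omega>'. open \<Omega>' \<and> compact (closure \<Omega>') \<and> closure \<Omega>' \<subseteq> \<Omega> \<longrightarrow> C11_closure \<Omega>' f)"

end

theory Submission
  imports Defs "HOL-Complex_Analysis.Cauchy_Integral_Formula"
begin

text \<open>
Let \<open>B\<close> be the unit ball and \<open>f\<close> the supremum of all plurisubharmonic \<open>v \<le> \<psi>\<close> on \<open>B\<close>. A
function has a Lipschitz derivative as soon as its second differences
\<open>f (z + h) + f (z - h) - 2 f z\<close> are bounded in absolute value by a multiple of \<open>|h|^2\<close>
(\<open>C11_from_second_differences\<close>), so the whole proof is about these differences. The method goes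
back to Bedford and Taylor: move competitors around by holomorphic self-maps of \<open>B\<close>.

First order. The affine map \<open>z \<mapsto> (1 - s) z + h\<close> with \<open>|h| \<le> s < 1\<close> maps \<open>B\<close> into itself and moves
points by at most \<open>2 s\<close>. Composing a competitor with it and subtracting \<open>2 \<Lambda> s\<close>, where \<open>\<Lambda>\<close> is a
Lipschitz constant of \<open>\<psi>\<close>, gives another competitor. Hence \<open>f\<close> is locally Lipschitz
(\<open>envelope_lipschitz\<close>). In particular \<open>f\<close> is continuous, agrees with its upper semicontinuous
regularization, and is itself plurisubharmonic.

Upper bound. For small \<open>a\<close> the map \<open>\<Phi> a z = c (z + a) / (1 + <z, a>)\<close> with \<open>c = 1 / (1 + 4 |a|^2)\<close>
maps \<open>B\<close> into itself, and \<open>\<Phi> a z = z + (a - <z, a> z) + O(|a|^2)\<close> uniformly on \<open>B\<close>. The first order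
term is odd in \<open>a\<close>, so, \<open>\<psi>\<close> being \<open>C^{1,1}\<close> up to the boundary, the average of \<open>f\<close> over \<open>\<Phi> a z\<close> and
\<open>\<Phi> (-a) z\<close> exceeds \<open>\<psi> z\<close> by at most \<open>C |a|^2\<close>. After subtraction of that constant it is a
competitor, whence \<open>f (\<Phi> a z) + f (\<Phi> (-a) z) - 2 f z \<le> 2 C |a|^2\<close>. On smaller balls
\<open>h = a - <z, a> z\<close> can be solved for \<open>a\<close>, and the Lipschitz bound absorbs the quadratic error in
\<open>\<Phi> a z = z + h + O(|a|^2)\<close>. That \<open>f (\<Phi> a z)\<close> is plurisubharmonic uses that \<open>\<Phi> a\<close> is projective: it
maps complex lines to complex lines, reparametrized by an automorphism of the unit disc, so that only
the invariance of the sub-mean value property under such automorphisms is needed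
(\<open>submean_moebius\<close>). It follows from the maximum principle and the mean value property of real parts
of holomorphic functions, since real parts of polynomials are dense in the continuous functions on
the circle.

Lower bound. The upper bound says that \<open>g = 2 A |z|^2 - f\<close> is convex for some \<open>A\<close>, while the
sub-mean value inequality bounds the average of the second differences of \<open>g\<close> over a circle in the
complex line spanned by \<open>h\<close> from above. By convexity the average controls each single second
difference (\<open>second_difference_lower_bound\<close>).
\<close>

section \<open>Averages over the unit circle\<close>

definition circle_avg :: "(complex \<Rightarrow> real) \<Rightarrow> real" where
  "circle_avg F = integral {0..2*pi} (\<lambda>t. F (cis t)) / (2*pi)"

lemma continuous_on_cis_circle:
  assumes "continuous_on (sphere 0 1) F"
  shows "continuous_on S (\<lambda>t. F (cis t))"
proof -
  have "continuous_on S cis" by (intro continuous_intros)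
  moreover have "cis ` S \<subseteq> sphere 0 1" by auto
  ultimately show ?thesis
    using assms continuous_on_compose2 by blast
qed

lemma circle_integrable:
  fixes F :: "complex \<Rightarrow> real"
  assumes "continuous_on (sphere 0 1) F"
  shows "(\<lambda>t. F (cis t)) integrable_on {0..2*pi}"
  by (intro integrable_continuous_interval continuous_on_cis_circle assms)

lemma circle_avg_mono:
  assumes "continuous_on (sphere 0 1) F" "continuous_on (sphere 0 1) G"
    and "\<And>\<omega>. norm \<omega> = 1 \<Longrightarrow> F \<omega> \<le> G \<omega>"
  shows "circle_avg F \<le> circle_avg G"
  unfolding circle_avg_def
  by (intro divide_right_mono integral_le circle_integrable assms) (auto intro: assms)

lemma circle_avg_cong:
  assumes "\<And>\<omega>. norm \<omega> = 1 \<Longrightarrow> F \<omega> = G \<omega>"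
  shows "circle_avg F = circle_avg G"
  unfolding circle_avg_def using assms by simp

lemma circle_avg_add:
  assumes "continuous_on (sphere 0 1) F" "continuous_on (sphere 0 1) G"
  shows "circle_avg (\<lambda>\<omega>. F \<omega> + G \<omega>) = circle_avg F + circle_avg G"
  unfolding circle_avg_def
  using integral_add[OF circle_integrable[OF assms(1)] circle_integrable[OF assms(2)]]
  by (simp add: add_divide_distrib)

lemma circle_avg_cmul: "circle_avg (\<lambda>\<omega>. c * F \<omega>) = c * circle_avg F"
  unfolding circle_avg_def by simp

lemma circle_avg_const [simp]: "circle_avg (\<lambda>\<omega>. c) = c"
  unfolding circle_avg_def by simp

lemma circle_avg_diff:
  assumes "continuous_on (sphere 0 1) F" "continuous_on (sphere 0 1) G"
  shows "circle_avg (\<lambda>\<omega>. F \<omega> - G \<omega>) = circle_avg F - circle_avg G"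
  unfolding circle_avg_def
  using integral_diff[OF circle_integrable[OF assms(1)] circle_integrable[OF assms(2)]]
  by (simp add: diff_divide_distrib)

text \<open>The mean value property, read off from the Cauchy integral formula at the centre.\<close>
lemma circle_avg_Re_holomorphic:
  assumes "continuous_on (cball p r) f" "f holomorphic_on ball p r" "0 < r"
  shows "circle_avg (\<lambda>\<omega>. Re (f (p + of_real r * \<omega>))) = Re (f p)"
proof -
  have "((\<lambda>u. f u/(u-p)) has_contour_integral (2 * of_real pi * \<i> * f p)) (circlepath p r)"
    using Cauchy_integral_circlepath[OF assms(1,2), of p] assms(3) by simp
  then have "((\<lambda>t. f (p + r * cis t) / (r * cis t) * r * \<i> * cis t) has_integral
      (2 * of_real pi * \<i> * f p)) {0..2*pi}"
    unfolding circlepath_def by (subst (asm) has_contour_integral_part_circlepath_iff) auto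
  then have "((\<lambda>t. \<i> * f (p + r * cis t)) has_integral (2 * of_real pi * \<i> * f p)) {0..2*pi}"
    by (rule has_integral_eq[rotated]) (use assms(3) in \<open>auto simp: field_simps\<close>)
  then have "((\<lambda>t. - \<i> * (\<i> * f (p + r * cis t))) has_integral - \<i> * (2 * of_real pi * \<i> * f p)) {0..2*pi}"
    by (rule has_integral_mult_right)
  then have "((\<lambda>t. f (p + r * cis t)) has_integral (2 * pi * f p)) {0..2*pi}"
    by (simp add: algebra_simps)
  then have "((\<lambda>t. Re (f (p + r * cis t))) has_integral Re (2 * pi * f p)) {0..2*pi}"
    by (rule has_integral_Re)
  then show ?thesis
    unfolding circle_avg_def by (simp add: integral_unique)
qed

lemma circle_avg_norm_sq:
  "circle_avg (\<lambda>\<omega>. (norm (p + of_real r * \<omega>))\<^sup>2) = (norm p)\<^sup>2 + r\<^sup>2"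
proof -
  have 1: "(norm (p + of_real r * \<omega>))\<^sup>2 = ((norm p)\<^sup>2 + r\<^sup>2) + Re (0 + 1 * \<omega> * (2 * of_real r * cnj p))"
    if "norm \<omega> = 1" for \<omega>
  proof -
    have "(Re \<omega>)\<^sup>2 + (Im \<omega>)\<^sup>2 = 1"
      using that by (metis cmod_power2 one_power2)
    then have "r\<^sup>2 * (Re \<omega>)\<^sup>2 + r\<^sup>2 * (Im \<omega>)\<^sup>2 = r\<^sup>2"
      by (metis distrib_left mult.right_neutral)
    then show ?thesis
      unfolding cmod_power2 by (simp add: power2_eq_square algebra_simps)
  qed
  have "circle_avg (\<lambda>\<omega>. (norm (p + of_real r * \<omega>))\<^sup>2) =
    circle_avg (\<lambda>\<omega>. ((norm p)\<^sup>2 + r\<^sup>2) + Re ((\<lambda>\<zeta>. \<zeta> * (2 * of_real r * cnj p)) (0 + of_real 1 * \<omega>)))"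
    by (rule circle_avg_cong) (use 1 in simp)
  also have "\<dots> = ((norm p)\<^sup>2 + r\<^sup>2) + circle_avg (\<lambda>\<omega>. Re ((\<lambda>\<zeta>. \<zeta> * (2 * of_real r * cnj p)) (0 + of_real 1 * \<omega>)))"
    by (subst circle_avg_add) (auto intro!: continuous_intros)
  also have "circle_avg (\<lambda>\<omega>. Re ((\<lambda>\<zeta>. \<zeta> * (2 * of_real r * cnj p)) (0 + of_real 1 * \<omega>))) = 0"
    by (subst circle_avg_Re_holomorphic) (auto intro!: continuous_intros holomorphic_intros)
  finally show ?thesis by simp
qed

section \<open>Invariance of the sub-mean value property under disc automorphisms\<close>

definition submean_disc :: "(complex \<Rightarrow> real) \<Rightarrow> bool" where
  "submean_disc u \<longleftrightarrow> continuous_on (cball 0 1) u \<and>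
    (\<forall>p r. 0 < r \<and> cball p r \<subseteq> cball 0 1 \<longrightarrow> u p \<le> circle_avg (\<lambda>\<omega>. u (p + of_real r * \<omega>)))"

lemma circle_in_cball:
  fixes p \<omega> :: complex
  assumes "norm \<omega> = 1" "0 < r" shows "p + of_real r * \<omega> \<in> cball p r"
  using assms by (simp add: dist_norm norm_mult)

lemma continuous_on_circle:
  fixes u :: "complex \<Rightarrow> real"
  assumes "continuous_on S u" "0 < r" "cball p r \<subseteq> S"
  shows "continuous_on (sphere 0 1) (\<lambda>\<omega>. u (p + of_real r * \<omega>))"
proof (rule continuous_on_compose2[OF assms(1)])
  show "(\<lambda>\<omega>. p + of_real r * \<omega>) ` sphere 0 1 \<subseteq> S"
    using circle_in_cball[of _ r p] assms by (auto simp: subset_iff dist_norm norm_mult)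
qed (intro continuous_intros)

text \<open>The perturbation \<open>e |\<zeta>|^2\<close> turns the sub-mean value inequality into a strict one, which excludes an
interior maximum at once.\<close>
lemma max_principle_disc:
  assumes "submean_disc u" and M: "\<And>\<omega>. norm \<omega> = 1 \<Longrightarrow> u \<omega> \<le> M" and z: "norm z \<le> 1"
  shows "u z \<le> M"
proof (rule field_le_epsilon)
  fix e :: real assume e: "0 < e"
  define w where "w = (\<lambda>\<zeta>. u \<zeta> + e * (norm \<zeta>)\<^sup>2)"
  have cu: "continuous_on (cball 0 1) u" using assms by (simp add: submean_disc_def)
  have "continuous_on (cball 0 1) w" unfolding w_def by (intro continuous_intros cu)
  then obtain p where p: "p \<in> cball 0 1" and max: "\<And>y. y \<in> cball 0 1 \<Longrightarrow> w y \<le> w p"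
    using continuous_attains_sup[of "cball (0::complex) 1" w] by auto
  have "norm p = 1"
  proof (rule ccontr)
    assume "norm p \<noteq> 1"
    then have lt: "norm p < 1" using p by simp
    define r where "r = 1 - norm p"
    have r: "0 < r" using lt by (simp add: r_def)
    have sub: "cball p r \<subseteq> cball 0 1"
      by (auto simp: r_def dist_norm) (metis (no_types, opaque_lifting) add.commute add_diff_cancel_left' diff_add_cancel diff_right_mono
         norm_minus_commute norm_triangle_sub order.trans le_diff_eq)
    have cont: "continuous_on (sphere 0 1) (\<lambda>\<omega>. u (p + of_real r * \<omega>))"
      by (rule continuous_on_circle[OF cu r sub])
    have "w p + e * r\<^sup>2 = u p + e * ((norm p)\<^sup>2 + r\<^sup>2)" by (simp add: w_def algebra_simps)
    also have "\<dots> \<le> circle_avg (\<lambda>\<omega>. u (p + of_real r * \<omega>)) + circle_avg (\<lambda>\<omega>. e * (norm (p + of_real r * \<omega>))\<^sup>2)"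
      using assms(1) r sub by (auto simp: submean_disc_def circle_avg_cmul circle_avg_norm_sq)
    also have "\<dots> = circle_avg (\<lambda>\<omega>. w (p + of_real r * \<omega>))"
      unfolding w_def by (rule circle_avg_add[symmetric]) (intro cont, intro continuous_intros)
    also have "\<dots> \<le> circle_avg (\<lambda>\<omega>. w p)"
    proof (rule circle_avg_mono)
      show "continuous_on (sphere 0 1) (\<lambda>\<omega>. w (p + of_real r * \<omega>))"
        by (rule continuous_on_circle[OF \<open>continuous_on (cball 0 1) w\<close> r sub])
      show "w (p + of_real r * \<omega>) \<le> w p" if "norm \<omega> = 1" for \<omega>
        using circle_in_cball[OF that r] sub max by blast
    qed auto
    finally have "e * r\<^sup>2 \<le> 0" by simp
    moreover have "0 < e * r\<^sup>2" using e r by simp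
    ultimately show False by linarith
  qed
  have "u z \<le> w z" using e by (simp add: w_def)
  also have "\<dots> \<le> w p" using max z by simp
  also have "\<dots> \<le> M + e" using M[OF \<open>norm p = 1\<close>] \<open>norm p = 1\<close> by (simp add: w_def)
  finally show "u z \<le> M + e" .
qed

text \<open>On the unit circle \<open>\<zeta> * cnj \<zeta> = 1\<close>, so mixed monomials reduce to pure powers of \<open>\<zeta>\<close> or of its
conjugate. This is why real parts of polynomials, restricted to the circle, form an algebra.\<close>
lemma Re_cnj_product_on_circle:
  "\<exists>S::complex poly. \<forall>\<omega>. norm \<omega> = 1 \<longrightarrow> Re (poly P \<omega> * cnj (poly Q \<omega>)) = Re (poly S \<omega>)"
proof (induction P arbitrary: Q)
  case 0
  show ?case by (rule exI[of _ 0]) simp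
next
  case (pCons a P)
  show ?case
  proof (cases Q)
    case (pCons b Q')
    obtain S where S: "norm \<omega> = 1 \<Longrightarrow> Re (poly P \<omega> * cnj (poly Q' \<omega>)) = Re (poly S \<omega>)" for \<omega>
      using pCons.IH[of Q'] by blast
    have "Re (poly (pCons a P) \<omega> * cnj (poly Q \<omega>)) =
        Re (poly (smult (cnj a) Q + pCons 0 (smult (cnj b) P) + S) \<omega>)" if w: "norm \<omega> = 1" for \<omega>
    proof -
      have 1: "\<omega> * cnj \<omega> = 1" using w by (simp add: complex_norm_square[symmetric])
      have "poly (pCons a P) \<omega> * cnj (poly Q \<omega>) =
         a * cnj (poly Q \<omega>) + \<omega> * cnj b * poly P \<omega> + (\<omega> * cnj \<omega>) * (poly P \<omega> * cnj (poly Q' \<omega>))"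
        by (simp add: pCons algebra_simps)
      moreover have "Re (a * cnj (poly Q \<omega>)) = Re (cnj a * poly Q \<omega>)" by simp
      ultimately show ?thesis
        using S[OF w] 1 by (simp add: algebra_simps)
    qed
    then show ?thesis by blast
  qed
qed

text \<open>With the Stone-Weierstrass theorem this makes the Dirichlet problem on the disc solvable for a dense
set of boundary data, with solutions that are real parts of polynomials.\<close>
lemma real_polynomial_on_circle_eq_Re_poly:
  assumes "real_polynomial_function g"
  shows "\<exists>P::complex poly. \<forall>\<omega>. norm \<omega> = 1 \<longrightarrow> g \<omega> = Re (poly P \<omega>)"
  using assms
proof (induction rule: real_polynomial_function.induct)
  case (linear f)
  have "f \<omega> = Re (poly [:0, Complex (f 1) (- f \<i>):] \<omega>)" for \<omega>
  proof -
    interpret bounded_linear f by fact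
    have "f \<omega> = f (Re \<omega> *\<^sub>R 1 + Im \<omega> *\<^sub>R \<i>)"
      by (rule arg_cong[where f=f]) (simp add: complex_eq_iff)
    also have "\<dots> = Re \<omega> * f 1 + Im \<omega> * f \<i>" by (simp add: add scaleR)
    finally show ?thesis by (simp add: algebra_simps)
  qed
  then show ?case by blast
next
  case (const c)
  show ?case by (rule exI[of _ "[:of_real c:]"]) simp
next
  case (add f g)
  then obtain P Q :: "complex poly" where "\<forall>\<omega>. norm \<omega> = 1 \<longrightarrow> f \<omega> = Re (poly P \<omega>)" "\<forall>\<omega>. norm \<omega> = 1 \<longrightarrow> g \<omega> = Re (poly Q \<omega>)"
    by blast
  then show ?case by (intro exI[of _ "P + Q"]) simp
next
  case (mult f g)
  then obtain P Q :: "complex poly" where PQ: "\<forall>\<omega>. norm \<omega> = 1 \<longrightarrow> f \<omega> = Re (poly P \<omega>)" "\<forall>\<omega>. norm \<omega> = 1 \<longrightarrow> g \<omega> = Re (poly Q \<omega>)"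
    by blast
  obtain S where S: "norm \<omega> = 1 \<Longrightarrow> Re (poly P \<omega> * cnj (poly Q \<omega>)) = Re (poly S \<omega>)" for \<omega>
    using Re_cnj_product_on_circle[of P Q] by blast
  have "f \<omega> * g \<omega> = Re (poly (smult (1/2) (P * Q + S)) \<omega>)" if w: "norm \<omega> = 1" for \<omega>
  proof -
    have "f \<omega> * g \<omega> = (Re (poly P \<omega> * poly Q \<omega>) + Re (poly P \<omega> * cnj (poly Q \<omega>))) / 2"
      using PQ w by (simp add: field_simps)
    then show ?thesis using S[OF w] by simp
  qed
  then show ?case by blast
qed

text \<open>For \<open>|\<sigma>| < 1\<close> the automorphism of the unit disc that sends 0 to \<open>\<sigma>\<close>; its inverse has parameter \<open>- \<sigma>\<close>.\<close>
definition disc_moebius :: "complex \<Rightarrow> complex \<Rightarrow> complex" where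
  "disc_moebius \<sigma> \<zeta> = (\<zeta> + \<sigma>) / (1 + cnj \<sigma> * \<zeta>)"

lemma disc_moebius_denom:
  assumes "norm \<sigma> < 1" "norm \<zeta> \<le> 1" shows "1 + cnj \<sigma> * \<zeta> \<noteq> 0"
proof
  assume "1 + cnj \<sigma> * \<zeta> = 0"
  then have "cnj \<sigma> * \<zeta> = - 1" by (simp add: eq_neg_iff_add_eq_0 add.commute)
  then have "norm \<sigma> * norm \<zeta> = 1" by (metis complex_mod_cnj norm_minus_cancel norm_mult norm_one)
  moreover have "norm \<sigma> * norm \<zeta> \<le> norm \<sigma> * 1" using assms by (intro mult_left_mono) auto
  ultimately show False using assms by simp
qed

lemma disc_moebius_sq_gap:
  "(norm (1 + cnj \<sigma> * \<zeta>))\<^sup>2 - (norm (\<zeta> + \<sigma>))\<^sup>2 = (1 - (norm \<sigma>)\<^sup>2) * (1 - (norm \<zeta>)\<^sup>2)"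
  unfolding cmod_power2 by (simp add: power2_eq_square algebra_simps)

lemma norm_disc_moebius_le:
  assumes "norm \<sigma> < 1" "norm \<zeta> \<le> 1" shows "norm (disc_moebius \<sigma> \<zeta>) \<le> 1"
proof -
  have "0 \<le> (1 - (norm \<sigma>)\<^sup>2) * (1 - (norm \<zeta>)\<^sup>2)"
    using assms by (intro mult_nonneg_nonneg) (auto simp: power_le_one)
  then have "(norm (\<zeta> + \<sigma>))\<^sup>2 \<le> (norm (1 + cnj \<sigma> * \<zeta>))\<^sup>2"
    using disc_moebius_sq_gap[of \<sigma> \<zeta>] by linarith
  then have "norm (\<zeta> + \<sigma>) \<le> norm (1 + cnj \<sigma> * \<zeta>)" by (rule power2_le_imp_le) simp
  then show ?thesis
    using disc_moebius_denom[OF assms] by (simp add: disc_moebius_def norm_divide)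
qed

lemma norm_disc_moebius_eq:
  assumes "norm \<sigma> < 1" "norm \<zeta> = 1" shows "norm (disc_moebius \<sigma> \<zeta>) = 1"
proof -
  have "(norm (\<zeta> + \<sigma>))\<^sup>2 = (norm (1 + cnj \<sigma> * \<zeta>))\<^sup>2"
    using disc_moebius_sq_gap[of \<sigma> \<zeta>] assms by simp
  then have "norm (\<zeta> + \<sigma>) = norm (1 + cnj \<sigma> * \<zeta>)" by (simp add: power2_eq_iff_nonneg)
  then show ?thesis
    using disc_moebius_denom[of \<sigma> \<zeta>] assms by (simp add: disc_moebius_def norm_divide)
qed

lemma disc_moebius_inverse:
  assumes "norm \<sigma> < 1" "norm \<zeta> \<le> 1" 
  shows "disc_moebius \<sigma> (disc_moebius (-\<sigma>) \<zeta>) = \<zeta>"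
proof -
  have d: "1 - cnj \<sigma> * \<zeta> \<noteq> 0" using disc_moebius_denom[of "-\<sigma>" \<zeta>] assms by simp
  have s: "1 - cnj \<sigma> * \<sigma> \<noteq> 0" using disc_moebius_denom[of "-\<sigma>" \<sigma>] assms by simp
  have "disc_moebius (-\<sigma>) \<zeta> + \<sigma> = (1 - cnj \<sigma> * \<sigma>) * \<zeta> / (1 - cnj \<sigma> * \<zeta>)"
    using d by (simp add: disc_moebius_def field_simps)
  moreover have "1 + cnj \<sigma> * disc_moebius (-\<sigma>) \<zeta> = (1 - cnj \<sigma> * \<sigma>) / (1 - cnj \<sigma> * \<zeta>)"
    using d by (simp add: disc_moebius_def field_simps)
  ultimately show ?thesis using d s by (simp add: disc_moebius_def[of \<sigma>])
qed

text \<open>The right-hand side is the Poisson integral of \<open>u\<close> at \<open>\<sigma>\<close>. If \<open>u\<close> is close to the real part of a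
polynomial \<open>P\<close> on the circle, then the maximum principle bounds \<open>u \<sigma>\<close> by \<open>Re (P \<sigma>)\<close> up to the error,
and \<open>P\<close> composed with the automorphism is holomorphic, so its value at 0 is its circle average.\<close>
lemma submean_moebius:
  assumes u: "submean_disc u" and s: "norm \<sigma> < 1"
  shows "u \<sigma> \<le> circle_avg (\<lambda>\<omega>. u (disc_moebius \<sigma> \<omega>))"
proof (rule field_le_epsilon)
  fix e :: real assume e: "0 < e"
  have cu: "continuous_on (cball 0 1) u" using u by (simp add: submean_disc_def)
  have "continuous_on (sphere 0 1) u" by (rule continuous_on_subset[OF cu]) auto
  then obtain g where g: "real_polynomial_function g" "\<And>\<omega>. \<omega> \<in> sphere 0 1 \<Longrightarrow> \<bar>u \<omega> - g \<omega>\<bar> < e/2"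
    using Stone_Weierstrass_real_polynomial_function[of "sphere 0 1" u "e/2"] e by auto
  obtain P :: "complex poly" where P: "norm \<omega> = 1 \<Longrightarrow> g \<omega> = Re (poly P \<omega>)" for \<omega>
    using real_polynomial_on_circle_eq_Re_poly[OF g(1)] by blast
  have close: "\<bar>u \<omega> - Re (poly P \<omega>)\<bar> \<le> e/2" if "norm \<omega> = 1" for \<omega>
    using g(2)[of \<omega>] P[OF that] that by simp
  define w where "w = (\<lambda>\<zeta>. u \<zeta> - Re (poly P \<zeta>))"
  have sw: "submean_disc w"
    unfolding submean_disc_def
  proof (intro conjI allI impI; (elim conjE)?)
    show "continuous_on (cball 0 1) w" unfolding w_def by (intro continuous_intros cu)
    fix p :: complex and r :: real assume r: "0 < r" and sub: "cball p r \<subseteq> cball 0 1"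
    have "w p \<le> circle_avg (\<lambda>\<omega>. u (p + of_real r * \<omega>)) - circle_avg (\<lambda>\<omega>. Re (poly P (p + of_real r * \<omega>)))"
      using u r sub by (subst circle_avg_Re_holomorphic)
        (auto simp: w_def submean_disc_def intro!: continuous_intros holomorphic_intros)
    also have "\<dots> = circle_avg (\<lambda>\<omega>. w (p + of_real r * \<omega>))"
      unfolding w_def
      by (rule circle_avg_diff[symmetric]) (intro continuous_on_circle[OF cu r sub], intro continuous_intros)
    finally show "w p \<le> circle_avg (\<lambda>\<omega>. w (p + of_real r * \<omega>))" .
  qed
  have wle: "w \<omega> \<le> e/2" if "norm \<omega> = 1" for \<omega>
    using close[OF that] unfolding w_def by linarith
  have "w \<sigma> \<le> e/2"
    by (rule max_principle_disc[OF sw wle]) (use s in auto)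
  then have "u \<sigma> \<le> Re (poly P \<sigma>) + e/2" by (simp add: w_def)
  also have "Re (poly P \<sigma>) = Re ((poly P \<circ> disc_moebius \<sigma>) 0)" by (simp add: disc_moebius_def)
  also have "\<dots> = circle_avg (\<lambda>\<omega>. Re ((poly P \<circ> disc_moebius \<sigma>) (0 + of_real 1 * \<omega>)))"
    by (rule circle_avg_Re_holomorphic[symmetric])
       (use disc_moebius_denom[OF s] in \<open>auto simp: disc_moebius_def o_def intro!: continuous_intros holomorphic_intros\<close>)
  also have "\<dots> \<le> circle_avg (\<lambda>\<omega>. u (disc_moebius \<sigma> \<omega>) + e/2)"
  proof (rule circle_avg_mono)
    have m: "continuous_on (sphere 0 1) (disc_moebius \<sigma>)"
      unfolding disc_moebius_def using disc_moebius_denom[OF s] by (intro continuous_intros) auto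
    show "continuous_on (sphere 0 1) (\<lambda>\<omega>. Re ((poly P \<circ> disc_moebius \<sigma>) (0 + of_real 1 * \<omega>)))"
      using m by (auto simp: o_def intro!: continuous_intros)
    show "continuous_on (sphere 0 1) (\<lambda>\<omega>. u (disc_moebius \<sigma> \<omega>) + e/2)"
      by (intro continuous_intros continuous_on_compose2[OF cu m])
         (use norm_disc_moebius_le[OF s] in auto)
    show "Re ((poly P \<circ> disc_moebius \<sigma>) (0 + of_real 1 * \<omega>)) \<le> u (disc_moebius \<sigma> \<omega>) + e/2" if "norm \<omega> = 1" for \<omega>
    proof -
      have "Re (poly P (disc_moebius \<sigma> \<omega>)) \<le> u (disc_moebius \<sigma> \<omega>) + e/2"
        using close[OF norm_disc_moebius_eq[OF s that]] by linarith
      then show ?thesis by simp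
    qed
  qed
  also have "\<dots> = circle_avg (\<lambda>\<omega>. u (disc_moebius \<sigma> \<omega>)) + e/2"
  proof (subst circle_avg_add)
    have m: "continuous_on (sphere 0 1) (disc_moebius \<sigma>)"
      unfolding disc_moebius_def using disc_moebius_denom[OF s] by (intro continuous_intros) auto
    show "continuous_on (sphere 0 1) (\<lambda>\<omega>. u (disc_moebius \<sigma> \<omega>))"
      by (intro continuous_on_compose2[OF cu m]) (use norm_disc_moebius_le[OF s] in auto)
  qed auto
  finally show "u \<sigma> \<le> circle_avg (\<lambda>\<omega>. u (disc_moebius \<sigma> \<omega>)) + e" by simp
qed

section \<open>Second differences, convexity and Lipschitz derivatives\<close>

text \<open>On a segment let \<open>\<phi>\<close> be the difference of \<open>g\<close> and its chord. At a maximum point \<open>t0\<close> of \<open>\<phi>\<close>, the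
reflection of the nearer end point in \<open>t0\<close> still lies in the unit interval, and \<open>\<phi>\<close> vanishes at
that end point. So midpoint convexity makes the maximum at most half of itself.\<close>
lemma midpoint_convex_imp_convex_on:
  fixes g :: "'a::real_normed_vector \<Rightarrow> real"
  assumes S: "convex S" and cont: "continuous_on S g"
    and mid: "\<And>x y. x \<in> S \<Longrightarrow> y \<in> S \<Longrightarrow> 2 * g (midpoint x y) \<le> g x + g y"
  shows "convex_on S g"
proof (rule convex_onI[OF _ S])
  fix t :: real and x y assume t: "0 < t" "t < 1" and x: "x \<in> S" and y: "y \<in> S"
  define p where "p = (\<lambda>t. x + t *\<^sub>R (y - x))"
  define \<phi> where "\<phi> = (\<lambda>t. g (p t) - ((1 - t) * g x + t * g y))"
  have pS: "p t \<in> S" if "t \<in> {0..1}" for t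
    using convexD_alt[OF S x y, of t] that by (simp add: p_def algebra_simps)
  have "continuous_on {0..1} \<phi>"
    unfolding \<phi>_def
    by (intro continuous_intros continuous_on_compose2[OF cont]) (auto simp: pS, auto simp: p_def intro!: continuous_intros)
  then obtain t0 where t0: "t0 \<in> {0..1}" and max: "\<And>t. t \<in> {0..1} \<Longrightarrow> \<phi> t \<le> \<phi> t0"
    using continuous_attains_sup[of "{0..1::real}" \<phi>] by auto
  have \<phi>_mid: "2 * \<phi> ((s + t) / 2) \<le> \<phi> s + \<phi> t" if "s \<in> {0..1}" "t \<in> {0..1}" for s t
  proof -
    have "p s + p t = (x + x) + (s + t) *\<^sub>R (y - x)"
      by (simp add: p_def scaleR_add_left)
    then have "p ((s + t) / 2) = midpoint (p s) (p t)"
      unfolding midpoint_def by (simp only: scaleR_add_right) (simp add: p_def flip: scaleR_add_right)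
    then show ?thesis
      using mid[OF pS[OF that(1)] pS[OF that(2)]] by (simp add: \<phi>_def field_simps)
  qed
  have ends: "\<phi> 0 = 0" "\<phi> 1 = 0" by (simp_all add: \<phi>_def p_def)
  have "\<phi> t0 \<le> 0"
  proof (cases "t0 \<le> 1/2")
    case True
    then show ?thesis using \<phi>_mid[of 0 "2*t0"] max[of "2*t0"] t0 ends by simp
  next
    case False
    then show ?thesis using \<phi>_mid[of 1 "2*t0-1"] max[of "2*t0-1"] t0 ends by simp
  qed
  then have "\<phi> t \<le> 0" using max[of t] t by simp
  then show "g ((1 - t) *\<^sub>R x + t *\<^sub>R y) \<le> (1 - t) * g x + t * g y" by (simp add: \<phi>_def p_def algebra_simps)
qed

lemma norm_sq_midpoint:
  fixes x y :: "'a::real_inner"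
  shows "(norm x)\<^sup>2 + (norm y)\<^sup>2 - 2 * (norm (midpoint x y))\<^sup>2 = (norm (x - y))\<^sup>2 / 2"
  by (simp add: midpoint_def power2_norm_eq_inner inner_add inner_diff inner_commute field_simps)

text \<open>Additivity gives integer multiples; replacing \<open>n t\<close> by its integer part costs a bounded error, so
\<open>n |G (t v) - t G v|\<close> stays bounded for all \<open>n\<close>.\<close>
lemma bounded_additive_imp_bounded_linear:
  fixes G :: "'a::real_normed_vector \<Rightarrow> real"
  assumes add: "\<And>v w. G (v + w) = G v + G w" and bd: "\<And>v. \<bar>G v\<bar> \<le> L * norm v"
  shows "bounded_linear G"
proof (rule bounded_linear_intro[OF add])
  have zero: "G 0 = 0" using add[of 0 0] by simp
  have neg: "G (- v) = - G v" for v using add[of v "-v"] zero by simp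
  have nat: "G (real n *\<^sub>R v) = real n * G v" for n v
    by (induction n) (simp_all add: zero add algebra_simps)
  have int: "G (of_int k *\<^sub>R v) = of_int k * G v" for k v
  proof (cases "0 \<le> k")
    case True
    then show ?thesis using nat[of "nat k" v] by simp
  next
    case False
    then show ?thesis using nat[of "nat (-k)" v] neg[of "real (nat (-k)) *\<^sub>R v"] by simp
  qed
  fix t v
  show "G (t *\<^sub>R v) = t *\<^sub>R G v"
  proof (rule ccontr)
    define \<delta> where "\<delta> = \<bar>G (t *\<^sub>R v) - t * G v\<bar>"
    assume "G (t *\<^sub>R v) \<noteq> t *\<^sub>R G v"
    then have "0 < \<delta>" by (simp add: \<delta>_def)
    then obtain n :: nat where n: "2 * L * norm v < n * \<delta>"
      using reals_Archimedean3 by blast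
    define s where "s = frac (n * t)"
    have s: "0 \<le> s" "s \<le> 1" by (simp_all add: s_def frac_lt_1 less_imp_le)
    have nt: "real n * t = of_int \<lfloor>n * t\<rfloor> + s" by (simp add: s_def frac_def)
    have "n * G (t *\<^sub>R v) = G ((n * t) *\<^sub>R v)" using nat[of n "t *\<^sub>R v"] by simp
    also have "\<dots> = of_int \<lfloor>n * t\<rfloor> * G v + G (s *\<^sub>R v)"
      by (subst nt) (simp add: scaleR_add_left add int)
    finally have "n * (G (t *\<^sub>R v) - t * G v) = G (s *\<^sub>R v) - s * G v"
      using nt by (simp add: algebra_simps) (metis (no_types, opaque_lifting) distrib_right mult.assoc mult.commute)
    then have "n * \<delta> = \<bar>G (s *\<^sub>R v) - s * G v\<bar>"
      unfolding \<delta>_def by (metis abs_mult abs_of_nat)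
    also have "\<dots> \<le> \<bar>G (s *\<^sub>R v)\<bar> + s * \<bar>G v\<bar>"
      using s by (metis abs_mult abs_of_nonneg abs_triangle_ineq4)
    also have "\<dots> \<le> L * norm v + 1 * (L * norm v)"
    proof (intro add_mono mult_mono bd s)
      have "0 \<le> L * norm v" using bd[of v] by linarith
      then show "\<bar>G (s *\<^sub>R v)\<bar> \<le> L * norm v"
        using bd[of "s *\<^sub>R v"] s mult_right_mono[of s 1 "L * norm v"] by (simp add: mult_ac)
    qed auto
    finally show False using n by simp
  qed
next
  show "norm (G v) \<le> norm v * L" for v using bd[of v] by (simp add: mult.commute)
qed

text \<open>The candidate for the derivative at \<open>x\<close> in direction \<open>v\<close> is the limit of the dyadic difference
quotients. The second difference bound makes consecutive quotients geometrically close, which gives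
both convergence and a first order Taylor formula with quadratic error. Applied to the points
\<open>x + v / 2^k\<close> and \<open>x + w / 2^k\<close>, it also gives additivity of the limit. The Lipschitz bound for the
derivative comes from comparing Taylor expansions at \<open>x\<close> and \<open>y\<close> at a common third point.\<close>
lemma C11_from_second_differences:
  fixes f :: "'a::real_normed_vector \<Rightarrow> real"
  assumes mid: "\<And>x y. x \<in> ball 0 R \<Longrightarrow> y \<in> ball 0 R \<Longrightarrow>
      \<bar>f x + f y - 2 * f (midpoint x y)\<bar> \<le> C * (norm (x - y))\<^sup>2"
    and lip: "\<And>x y. x \<in> ball 0 R \<Longrightarrow> y \<in> ball 0 R \<Longrightarrow> \<bar>f x - f y\<bar> \<le> L * norm (x - y)"
    and r: "0 < r" "r < R" and C: "0 \<le> C"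
  shows "\<exists>(D :: 'a \<Rightarrow> 'a \<Rightarrow>\<^sub>L real) K. (\<forall>x\<in>ball 0 R. (f has_derivative blinfun_apply (D x)) (at x)) \<and>
      K-lipschitz_on (cball 0 r) D"
proof -
  let ?S = "ball (0::'a) R"
  define d where "d = (\<lambda>x v k. 2^k * (f (x + (1/2^k) *\<^sub>R v) - f x))"
  define G where "G = (\<lambda>x v. lim (d x v))"
  have near: "\<forall>\<^sub>F k in sequentially. x + (1/2^k) *\<^sub>R v \<in> ?S" if "x \<in> ?S" for x v
  proof -
    have "(\<lambda>k::nat. (1/2::real)^k) \<longlonglongrightarrow> 0" by (intro LIMSEQ_realpow_zero) auto
    then have "(\<lambda>k. x + ((1/2)^k) *\<^sub>R v) \<longlonglongrightarrow> x + 0 *\<^sub>R v"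
      by (intro tendsto_add tendsto_scaleR tendsto_const)
    then have "\<forall>\<^sub>F k in sequentially. x + ((1/2)^k) *\<^sub>R v \<in> ?S"
      by (rule topological_tendstoD[OF _ open_ball]) (use that in simp)
    then show ?thesis by (simp add: power_divide)
  qed
  have step: "\<bar>d x v k + d x w k - d x (v + w) (Suc k)\<bar> \<le> C * (norm (v - w))\<^sup>2 * (1/2)^k"
    if "x + (1/2^k) *\<^sub>R v \<in> ?S" "x + (1/2^k) *\<^sub>R w \<in> ?S" for x v w k
  proof -
    have m: "midpoint (x + (1/2^k) *\<^sub>R v) (x + (1/2^k) *\<^sub>R w) = x + (1/2^Suc k) *\<^sub>R (v + w)"
      by (simp add: midpoint_def algebra_simps flip: scaleR_2)
    have "d x v k + d x w k - d x (v + w) (Suc k) =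
      2^k * (f (x + (1/2^k) *\<^sub>R v) + f (x + (1/2^k) *\<^sub>R w) - 2 * f (x + (1/2^Suc k) *\<^sub>R (v + w)))"
      unfolding d_def by (simp add: algebra_simps)
    then have "\<bar>d x v k + d x w k - d x (v + w) (Suc k)\<bar> \<le> 2^k * (C * (norm ((1/2^k) *\<^sub>R (v - w)))\<^sup>2)"
      using mid[OF that] unfolding m by (simp add: abs_mult scaleR_diff_right)
    also have "\<dots> = C * (norm (v - w))\<^sup>2 * (1/2)^k"
      by (simp add: power_divide power_mult_distrib power2_eq_square)
    finally show ?thesis .
  qed
  have main: "d x v \<longlonglongrightarrow> G x v \<and> \<bar>f (x + v) - f x - G x v\<bar> \<le> 2 * C * (norm v)\<^sup>2"
    if x: "x \<in> ?S" and xv: "x + v \<in> ?S" for x v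
  proof -
    have in_S: "x + (1/2^k) *\<^sub>R v \<in> ?S" for k
    proof -
      have "(1 - 1/2^k) *\<^sub>R x + (1/2^k) *\<^sub>R (x + v) \<in> ?S"
        by (rule convexD_alt[OF convex_ball x xv]) auto
      then show ?thesis by (simp add: algebra_simps)
    qed
    have st: "\<bar>d x v (Suc k) - d x v k\<bar> \<le> C * (norm v)\<^sup>2 * (1/2)^k" for k
    proof -
      have "d x 0 k = 0" by (simp add: d_def)
      then show ?thesis using step[OF in_S, of k 0] x by (simp add: abs_minus_commute)
    qed
    have geo: "(\<lambda>k. C * (norm v)\<^sup>2 * (1/2)^k) sums (C * (norm v)\<^sup>2 * 2)"
      using sums_mult[OF geometric_sums[of "1/2::real"], of "C * (norm v)\<^sup>2"] by (simp add: power_divide)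
    have sm: "summable (\<lambda>k. d x v (Suc k) - d x v k)"
      by (rule summable_comparison_test[OF _ sums_summable[OF geo]]) (use st in auto)
    have "(\<lambda>n. \<Sum>k<n. d x v (Suc k) - d x v k) \<longlonglongrightarrow> (\<Sum>k. d x v (Suc k) - d x v k)"
      by (rule summable_LIMSEQ[OF sm])
    then have "(\<lambda>n. d x v n - d x v 0) \<longlonglongrightarrow> (\<Sum>k. d x v (Suc k) - d x v k)"
      by (simp add: sum_lessThan_telescope)
    from tendsto_add[OF this tendsto_const[of "d x v 0"]]
    have lim: "d x v \<longlonglongrightarrow> (\<Sum>k. d x v (Suc k) - d x v k) + d x v 0" by simp
    then have G: "G x v = (\<Sum>k. d x v (Suc k) - d x v k) + d x v 0"
      unfolding G_def by (rule limI)
    have "\<bar>\<Sum>k. d x v (Suc k) - d x v k\<bar> \<le> C * (norm v)\<^sup>2 * 2"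
      using norm_suminf_le[of "\<lambda>k. d x v (Suc k) - d x v k", OF _ sums_summable[OF geo]] st sums_unique[OF geo] by simp
    then show ?thesis using lim G by (simp add: d_def)
  qed
  have lim: "d x v \<longlonglongrightarrow> G x v" if x: "x \<in> ?S" for x v
  proof -
    obtain j where j: "x + (1/2^j) *\<^sub>R v \<in> ?S"
      using near[OF x, of v] by (auto simp: eventually_sequentially)
    have "d x v (k + j) = 2^j * d x ((1/2^j) *\<^sub>R v) k" for k
      by (simp add: d_def power_add)
    then have "(\<lambda>k. d x v (k + j)) \<longlonglongrightarrow> 2^j * G x ((1/2^j) *\<^sub>R v)"
      using tendsto_mult_left[OF conjunct1[OF main[OF x j]], of "2^j"] by simp
    then have "d x v \<longlonglongrightarrow> 2^j * G x ((1/2^j) *\<^sub>R v)"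
      by (rule LIMSEQ_offset)
    then show ?thesis unfolding G_def by (metis limI)
  qed
  have bl: "bounded_linear (G x)" if x: "x \<in> ?S" for x
  proof (rule bounded_additive_imp_bounded_linear)
    fix v w
    have "(\<lambda>k. d x v k + d x w k - d x (v + w) (Suc k)) \<longlonglongrightarrow> G x v + G x w - G x (v + w)"
      by (intro tendsto_intros lim x LIMSEQ_Suc)
    moreover have "(\<lambda>k. d x v k + d x w k - d x (v + w) (Suc k)) \<longlonglongrightarrow> 0"
    proof (rule Lim_null_comparison)
      show "\<forall>\<^sub>F k in sequentially. norm (d x v k + d x w k - d x (v + w) (Suc k)) \<le> C * (norm (v - w))\<^sup>2 * (1/2)^k"
        using near[OF x, of v] near[OF x, of w] by eventually_elim (use step in simp)
      show "(\<lambda>k. C * (norm (v - w))\<^sup>2 * (1/2)^k) \<longlonglongrightarrow> 0"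
        by (intro tendsto_mult_right_zero LIMSEQ_realpow_zero) auto
    qed
    ultimately show "G x (v + w) = G x v + G x w" using LIMSEQ_unique by fastforce
  next
    fix v
    have "\<forall>\<^sub>F k in sequentially. \<bar>d x v k\<bar> \<le> L * norm v"
      using near[OF x, of v]
    proof eventually_elim
      case (elim k)
      have "\<bar>d x v k\<bar> \<le> 2^k * (L * norm ((1/2^k) *\<^sub>R v))"
        using lip[OF elim x] by (simp add: d_def abs_mult) (simp add: field_simps)
      then show ?case by simp
    qed
    then show "\<bar>G x v\<bar> \<le> L * norm v"
      by (intro tendsto_upperbound[OF tendsto_rabs[OF lim[OF x]]]) auto
  qed
  define D where "D = (\<lambda>x. Blinfun (G x))"
  have D: "blinfun_apply (D x) = G x" if "x \<in> ?S" for x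
    using bounded_linear_Blinfun_apply[OF bl[OF that]] by (simp add: D_def)
  have taylor: "\<bar>f y - f x - G x (y - x)\<bar> \<le> 2 * C * (norm (y - x))\<^sup>2" if "x \<in> ?S" "y \<in> ?S" for x y
    using main[of x "y - x"] that by simp
  have deriv: "(f has_derivative blinfun_apply (D x)) (at x)" if x: "x \<in> ?S" for x
  proof -
    obtain e where e: "0 < e" "ball x e \<subseteq> ?S" using x openE[OF open_ball] by metis
    show ?thesis unfolding D[OF x]
    proof (rule has_derivativeI_sandwich[OF e(1) bl[OF x]])
      fix y assume y: "y \<noteq> x" "dist y x < e"
      then have "y \<in> ?S" using e(2) by (auto simp: dist_commute subset_iff)
      then have "norm (f y - f x - G x (y - x)) \<le> 2 * C * (norm (y - x))\<^sup>2" using taylor[OF x] by simp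
      then show "norm (f y - f x - G x (y - x)) / norm (y - x) \<le> 2 * C * norm (y - x)"
        using y(1) by (simp add: divide_le_eq power2_eq_square)
    next
      have "((\<lambda>y. 2 * C * norm (y - x)) \<longlongrightarrow> 2 * C * norm (x - x)) (at x)" by (intro tendsto_intros)
      then show "((\<lambda>y. 2 * C * norm (y - x)) \<longlongrightarrow> 0) (at x)" by simp
    qed
  qed
  \<comment> \<open>Two points of the closed ball of radius \<open>r\<close> are at distance \<open>\<delta> \<le> 2 r\<close>, so a step of length
    \<open>\<kappa> \<delta>\<close> from \<open>y\<close> stays inside the ball of radius \<open>R\<close>.\<close>
  define \<kappa> where "\<kappa> = (R - r) / (4 * r)"
  have \<kappa>: "0 < \<kappa>" using r by (simp add: \<kappa>_def)
  define K where "K = 2 * C * (\<kappa>\<^sup>2 + (1 + \<kappa>)\<^sup>2 + 1) / \<kappa>"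
  have K0: "0 \<le> K" using C \<kappa> by (simp add: K_def)
  have "K-lipschitz_on (cball 0 r) D"
  proof (rule lipschitz_onI[OF _ K0])
    fix x y :: 'a assume "x \<in> cball 0 r" "y \<in> cball 0 r"
    then have nx: "norm x \<le> r" and ny: "norm y \<le> r" by simp_all
    then have x: "x \<in> ?S" and y: "y \<in> ?S" using r by auto
    define \<delta> where "\<delta> = norm (x - y)"
    have \<delta>2: "\<delta> \<le> 2 * r" using norm_triangle_ineq4[of x y] nx ny by (simp add: \<delta>_def)
    have key: "\<bar>G x v - G y v\<bar> \<le> K * \<kappa> * \<delta>\<^sup>2" if v: "norm v = \<kappa> * \<delta>" for v
    proof -
      have "norm v \<le> \<kappa> * (2 * r)" using v \<delta>2 \<kappa> by simp
      also have "\<dots> < R - r" using r by (simp add: \<kappa>_def)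
      finally have vR: "norm v < R - r" .
      define w where "w = y + v"
      have w: "w \<in> ?S" using norm_triangle_ineq[of y v] vR ny by (simp add: w_def)
      have t1: "\<bar>f w - f y - G y v\<bar> \<le> 2 * C * (\<kappa> * \<delta>)\<^sup>2"
        using taylor[OF y w] v by (simp add: w_def)
      have "norm (w - x) \<le> \<delta> + \<kappa> * \<delta>"
        using norm_triangle_ineq[of "y - x" v] v by (simp add: w_def \<delta>_def norm_minus_commute algebra_simps)
      then have "(norm (w - x))\<^sup>2 \<le> ((1 + \<kappa>) * \<delta>)\<^sup>2"
        by (intro power_mono) (simp_all add: algebra_simps)
      then have t2: "\<bar>f w - f x - G x (w - x)\<bar> \<le> 2 * C * ((1 + \<kappa>) * \<delta>)\<^sup>2"
        using taylor[OF x w] mult_left_mono[of _ _ "2 * C"] C by fastforce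
      have t3: "\<bar>f y - f x - G x (y - x)\<bar> \<le> 2 * C * \<delta>\<^sup>2"
        using taylor[OF x y] by (simp add: \<delta>_def norm_minus_commute)
      have "G x (w - x) = G x (y - x) + G x v"
        using linear_add[OF bounded_linear.linear[OF bl[OF x]], of "y - x" v] by (simp add: w_def algebra_simps)
      then have "\<bar>G x v - G y v\<bar> \<le> 2 * C * (\<kappa> * \<delta>)\<^sup>2 + 2 * C * ((1 + \<kappa>) * \<delta>)\<^sup>2 + 2 * C * \<delta>\<^sup>2"
        using t1 t2 t3 by linarith
      also have "\<dots> = 2 * C * (\<kappa>\<^sup>2 + (1 + \<kappa>)\<^sup>2 + 1) * \<delta>\<^sup>2"
        by (simp add: power_mult_distrib[of _ \<delta>] ring_distribs(1)[of "2 * C"] ring_distribs(2)[of _ _ "\<delta>\<^sup>2"])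
      also have "\<dots> = K * \<kappa> * \<delta>\<^sup>2" using \<kappa> by (simp add: K_def)
      finally show ?thesis .
    qed
    have "norm (D x - D y) \<le> K * \<delta>"
    proof (rule norm_blinfun_bound)
      show "0 \<le> K * \<delta>" using K0 by (simp add: \<delta>_def)
      fix h
      show "norm (blinfun_apply (D x - D y) h) \<le> K * \<delta> * norm h"
      proof (cases "x = y \<or> h = 0")
        case False
        then have pos: "0 < \<delta>" "0 < norm h" by (simp_all add: \<delta>_def)
        define c where "c = \<kappa> * \<delta> / norm h"
        have c: "0 < c" using pos \<kappa> by (simp add: c_def)
        have "norm (c *\<^sub>R h) = \<kappa> * \<delta>" using pos \<kappa> by (simp add: c_def)
        from key[OF this] have "c * \<bar>G x h - G y h\<bar> \<le> K * \<kappa> * \<delta>\<^sup>2"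
          using c by (simp add: linear_scale[OF bounded_linear.linear[OF bl[OF x]]]
            linear_scale[OF bounded_linear.linear[OF bl[OF y]]] abs_mult flip: right_diff_distrib)
        also have "\<dots> = c * (K * \<delta> * norm h)" using pos by (simp add: c_def power2_eq_square)
        finally have "\<bar>G x h - G y h\<bar> \<le> K * \<delta> * norm h" using c by simp
        then show ?thesis by (simp add: D[OF x] D[OF y] blinfun.diff_left)
      qed (use K0 in \<open>auto simp: blinfun.diff_left \<delta>_def\<close>)
    qed
    then show "dist (D x) (D y) \<le> K * dist x y" by (simp add: dist_norm \<delta>_def)
  qed
  then show ?thesis using deriv by blast
qed

section \<open>Circle means and plurisubharmonic functions\<close>

lemma norm_vector_smult: "norm (c *s (v :: complex ^ 'n)) = norm c * norm v"
  unfolding norm_vec_def by (simp add: norm_mult L2_set_right_distrib)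

lemma bounded_linear_smult_vector: "bounded_linear (\<lambda>\<zeta>. \<zeta> *s (w :: complex ^ 'n))"
  by (rule bounded_linear_intro[where K="norm w"])
     (simp_all add: vector_sadd_rdistrib norm_vector_smult, simp add: vec_eq_iff)

lemmas continuous_on_smult_vector [continuous_intros] =
  bounded_linear.continuous_on[OF bounded_linear_smult_vector]

lemma of_real_smult: "of_real r *s (v :: complex ^ 'n) = r *\<^sub>R v"
  by (simp add: vec_eq_iff) (simp add: scaleR_conv_of_real)

lemma ennreal_max_0: "ennreal (max a 0) = ennreal a"
  by (simp add: max_def ennreal_neg)

lemma nn_integral_continuous_interval:
  fixes G :: "real \<Rightarrow> real"
  assumes "continuous_on UNIV G" "\<And>t. 0 \<le> G t"
  shows "(\<integral>\<^sup>+ t \<in> {a..b}. ennreal (G t) \<partial>lborel) = ennreal (integral {a..b} G)"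
proof -
  have "(G has_integral integral {a..b} G) {a..b}"
    by (intro integrable_integral integrable_continuous_interval continuous_on_subset[OF assms(1)]) auto
  then have I: "((\<lambda>t. if t \<in> {a..b} then G t else 0) has_integral integral {a..b} G) UNIV"
    by (simp only: has_integral_restrict_UNIV)
  have m: "(\<lambda>t. if t \<in> {a..b} then G t else 0) \<in> borel_measurable borel"
    using borel_measurable_continuous_onI[OF assms(1)] by measurable
  have "(\<integral>\<^sup>+ t. ennreal (if t \<in> {a..b} then G t else 0) \<partial>lborel) = ennreal (integral {a..b} G)"
    by (rule nn_integral_has_integral_lborel[OF m _ I]) (simp add: assms)
  moreover have "(\<lambda>t. ennreal (if t \<in> {a..b} then G t else 0)) = (\<lambda>t. ennreal (G t) * indicator {a..b} t)"
    by (auto simp: indicator_def)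
  ultimately show ?thesis by simp
qed

text \<open>For continuous real functions the difference of the two Lebesgue integrals is an ordinary integral.\<close>
lemma circle_mean_real:
  assumes "continuous_on (sphere 0 1) (\<lambda>\<omega>. u (a + of_real r * \<omega>))"
  shows "circle_mean (\<lambda>\<zeta>. ereal (u \<zeta>)) a r = ereal (circle_avg (\<lambda>\<omega>. u (a + of_real r * \<omega>)))"
proof -
  define F where "F = (\<lambda>t. u (a + of_real r * cis t))"
  have cF: "continuous_on S F" for S
    unfolding F_def by (rule continuous_on_cis_circle[OF assms])
  have p: "(\<integral>\<^sup>+ t \<in> {0..2*pi}. ennreal (F t) \<partial>lborel) = ennreal (integral {0..2*pi} (\<lambda>t. max (F t) 0))"
    using nn_integral_continuous_interval[of "\<lambda>t. max (F t) 0"] cF ennreal_max_0 by (simp add: continuous_on_max)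
  have n: "(\<integral>\<^sup>+ t \<in> {0..2*pi}. ennreal (- F t) \<partial>lborel) = ennreal (integral {0..2*pi} (\<lambda>t. max (- F t) 0))"
    using nn_integral_continuous_interval[of "\<lambda>t. max (- F t) 0"] 
    using cF ennreal_max_0 by (simp add: continuous_on_max continuous_on_minus)
  have "integral {0..2*pi} (\<lambda>t. max (F t) 0) - integral {0..2*pi} (\<lambda>t. max (- F t) 0)
      = integral {0..2*pi} (\<lambda>t. max (F t) 0 - max (- F t) 0)"
    by (intro integral_diff[symmetric] integrable_continuous_interval continuous_intros continuous_on_max cF)
  also have "(\<lambda>t. max (F t) 0 - max (- F t) 0) = F" by auto
  finally have d: "integral {0..2*pi} (\<lambda>t. max (F t) 0) - integral {0..2*pi} (\<lambda>t. max (- F t) 0)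
      = integral {0..2*pi} F" .
  have nn: "0 \<le> integral {0..2*pi} (\<lambda>t. max (F t) 0)" "0 \<le> integral {0..2*pi} (\<lambda>t. max (- F t) 0)"
    by (auto intro!: integral_nonneg integrable_continuous_interval continuous_intros continuous_on_max cF)
  have "circle_mean (\<lambda>\<zeta>. ereal (u \<zeta>)) a r =
      (enn2ereal (\<integral>\<^sup>+ t \<in> {0..2*pi}. ennreal (F t) \<partial>lborel)
       - enn2ereal (\<integral>\<^sup>+ t \<in> {0..2*pi}. ennreal (- F t) \<partial>lborel)) / ereal (2 * pi)"
    by (simp add: circle_mean_def F_def)
  also have "\<dots> = ereal (integral {0..2*pi} F / (2 * pi))"
    unfolding p n using d nn by (simp add: enn2ereal_ennreal)
  finally show ?thesis by (simp add: circle_avg_def F_def)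
qed

lemma circle_mean_mono:
  assumes "\<And>\<zeta>. norm (\<zeta> - a) = \<bar>r\<bar> \<Longrightarrow> u \<zeta> \<le> v \<zeta>"
  shows "circle_mean u a r \<le> circle_mean v a r"
proof -
  have "u (a + of_real r * cis t) \<le> v (a + of_real r * cis t)" for t
    by (rule assms) (simp add: norm_mult)
  then show ?thesis
    unfolding circle_mean_def
    by (intro ereal_divide_right_mono ereal_minus_mono iffD1[OF less_eq_ennreal.rep_eq] nn_integral_mono mult_right_mono e2ennreal_mono)
       (auto simp: ereal_minus_le_minus)
qed

text \<open>Splitting \<open>x\<close> and \<open>x - c\<close> into positive and negative parts. The identity is arranged without
subtraction of extended nonnegative numbers, so that it also holds at \<open>- \<infinity>\<close>, where both sides are
infinite.\<close>
lemma positive_negative_parts_shift: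
  fixes x :: ereal
  assumes "x \<noteq> \<infinity>" "0 \<le> c"
  shows "e2ennreal (x - ereal c) + e2ennreal (- x) + ennreal c = e2ennreal x + e2ennreal (- (x - ereal c))"
proof (cases x)
  case (real y)
  have "ennreal (y - c) + ennreal (- y) + ennreal c = ennreal y + ennreal (c - y)"
  proof -
    have "ennreal (max (y - c) 0) + ennreal (max (- y) 0) + ennreal c = ennreal (max y 0) + ennreal (max (c - y) 0)"
      using assms(2) by (simp flip: ennreal_plus)
    then show ?thesis by (simp add: ennreal_max_0)
  qed
  then show ?thesis by (simp add: real)
next
  case MInf
  then show ?thesis by simp
qed (use assms in auto)

text \<open>Integrating the previous identity. The upper bound on \<open>u\<close> keeps the integrals of the positive parts
finite; if the integral of the negative part is infinite, the left-hand side is \<open>- \<infinity>\<close>.\<close>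
lemma circle_mean_minus_const_ge:
  assumes m: "(\<lambda>t. u (a + of_real r * cis t)) \<in> borel_measurable borel"
    and bd: "\<And>t. u (a + of_real r * cis t) \<le> ereal N" and c: "0 \<le> c"
  shows "circle_mean u a r - ereal c \<le> circle_mean (\<lambda>\<zeta>. u \<zeta> - ereal c) a r"
proof -
  define F where "F = (\<lambda>t. u (a + of_real r * cis t))"
  have [measurable]: "F \<in> borel_measurable borel" using m by (simp add: F_def)
  define I where "I = (\<lambda>g :: real \<Rightarrow> ereal. \<integral>\<^sup>+ t \<in> {0..2*pi}. e2ennreal (g t) \<partial>lborel)"
  have len: "(\<integral>\<^sup>+ t \<in> {0..2*pi}. ennreal k \<partial>lborel) = ennreal (2 * pi * k)" if "0 \<le> k" for k
    using that by (simp add: nn_integral_cmult ennreal_mult'[symmetric] mult.commute)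
  have Fneq: "F t \<noteq> \<infinity>" for t using bd[of t] by (auto simp: F_def)
  have fin: "I F < top"
  proof -
    have "I F \<le> (\<integral>\<^sup>+ t \<in> {0..2*pi}. ennreal \<bar>N\<bar> \<partial>lborel)"
      unfolding I_def
    proof (intro nn_integral_mono mult_right_mono)
      fix t
      have "F t \<le> ereal \<bar>N\<bar>" using bd[of t] by (auto simp: F_def intro: order_trans)
      then show "e2ennreal (F t) \<le> ennreal \<bar>N\<bar>" using e2ennreal_mono by fastforce
    qed auto
    also have "\<dots> < top" by (simp add: len)
    finally show ?thesis .
  qed
  have fin': "I (\<lambda>t. F t - ereal c) < top"
  proof -
    have "F t - ereal c \<le> F t" for t using c by (cases "F t") auto
    then have "I (\<lambda>t. F t - ereal c) \<le> I F"
      unfolding I_def by (intro nn_integral_mono mult_right_mono e2ennreal_mono) auto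
    then show ?thesis using fin by (rule order.strict_trans1)
  qed
  have eq: "I (\<lambda>t. F t - ereal c) + I (\<lambda>t. - F t) + ennreal (2 * pi * c) = I F + I (\<lambda>t. - (F t - ereal c))"
  proof -
    have "I (\<lambda>t. F t - ereal c) + I (\<lambda>t. - F t) + ennreal (2 * pi * c) =
      (\<integral>\<^sup>+ t \<in> {0..2*pi}. (e2ennreal (F t - ereal c) + e2ennreal (- F t) + ennreal c) \<partial>lborel)"
      unfolding I_def len[OF c, symmetric]
      by (simp add: distrib_right nn_integral_add)
    also have "\<dots> = (\<integral>\<^sup>+ t \<in> {0..2*pi}. (e2ennreal (F t) + e2ennreal (- (F t - ereal c))) \<partial>lborel)"
      by (simp only: positive_negative_parts_shift[OF Fneq c])
    also have "\<dots> = I F + I (\<lambda>t. - (F t - ereal c))"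
      unfolding I_def by (simp add: distrib_right nn_integral_add)
    finally show ?thesis .
  qed
  have cm: "circle_mean u a r = (enn2ereal (I F) - enn2ereal (I (\<lambda>t. - F t))) / ereal (2 * pi)"
    "circle_mean (\<lambda>\<zeta>. u \<zeta> - ereal c) a r =
      (enn2ereal (I (\<lambda>t. F t - ereal c)) - enn2ereal (I (\<lambda>t. - (F t - ereal c)))) / ereal (2 * pi)"
    by (simp_all add: circle_mean_def I_def F_def)
  obtain A A' where A: "0 \<le> A" "I F = ennreal A" and A': "0 \<le> A'" "I (\<lambda>t. F t - ereal c) = ennreal A'"
    using fin fin' by (metis ennreal_cases less_irrefl)
  show ?thesis
  proof (cases "I (\<lambda>t. - F t)" rule: ennreal_cases)
    case top
    then show ?thesis unfolding cm using A by (simp add: enn2ereal_ennreal)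
  next
    case (real B)
    have "I (\<lambda>t. - (F t - ereal c)) \<noteq> top"
      using eq A A' real c by (auto simp flip: ennreal_plus)
    then obtain B' where B': "0 \<le> B'" "I (\<lambda>t. - (F t - ereal c)) = ennreal B'"
      by (metis ennreal_cases)
    have "A' + B + 2 * pi * c = A + B'"
      using eq A A' real B' c by (simp flip: ennreal_plus)
    then have "(A - B) / (2 * pi) - c = (A' - B') / (2 * pi)" by (simp add: field_simps)
    then show ?thesis unfolding cm using A A' B' real by (simp add: enn2ereal_ennreal)
  qed
qed

lemma circle_mean_on_line:
  fixes u :: "complex ^ 'n \<Rightarrow> ereal"
  shows "circle_mean (\<lambda>\<zeta>. u (a + \<zeta> *s w)) p r = circle_mean (\<lambda>\<zeta>. u ((a + p *s w) + \<zeta> *s (r *\<^sub>R w))) 0 1"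
proof -
  have "a + (p + of_real r * \<omega>) *s w = (a + p *s w) + \<omega> *s (r *\<^sub>R w)" for \<omega>
    by (simp add: of_real_smult[symmetric] vector_smult_assoc vector_sadd_rdistrib mult.commute[of \<omega>] add.assoc)
  then show ?thesis by (simp only: circle_mean_def of_real_1 mult_1 add_0_left)
qed

lemma open_usc_sublevel:
  assumes "open U" "usc_on U u" shows "open {z \<in> U. u z < c}"
  using assms openin_open_trans unfolding usc_on_def by blast

text \<open>A circle of radius \<open>r\<close> around \<open>a + p w\<close> in the line with direction \<open>w\<close> is the unit circle of the line
with direction \<open>r w\<close>, so it suffices to test unit discs with arbitrary centre and direction.\<close>
lemma PSH_I:
  fixes u :: "complex ^ 'n \<Rightarrow> ereal"
  assumes U: "open U" and usc: "usc_on U u" and fin: "\<And>z. z \<in> U \<Longrightarrow> u z < \<infinity>" "\<And>z. z \<in> U \<Longrightarrow> u z \<noteq> - \<infinity>"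
    and sub: "\<And>z v. (\<And>\<zeta>. norm \<zeta> \<le> 1 \<Longrightarrow> z + \<zeta> *s v \<in> U) \<Longrightarrow> u z \<le> circle_mean (\<lambda>\<zeta>. u (z + \<zeta> *s v)) 0 1"
  shows "u \<in> PSH U"
  unfolding PSH_def
proof (intro CollectI conjI ballI allI)
  fix C assume "C \<in> components U"
  then obtain z where "z \<in> C" "z \<in> U" using in_components_nonempty in_components_subset by fastforce
  then show "\<exists>z\<in>C. u z \<noteq> - \<infinity>" using fin(2) by blast
next
  fix a w :: "complex ^ 'n"
  let ?T = "{\<zeta>. a + \<zeta> *s w \<in> U}"
  show "subharmonic_on ?T (\<lambda>\<zeta>. u (a + \<zeta> *s w))"
    unfolding subharmonic_on_def
  proof (intro conjI ballI allI impI; (elim conjE)?)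
    show "usc_on ?T (\<lambda>\<zeta>. u (a + \<zeta> *s w))"
      unfolding usc_on_def
    proof
      fix c
      have "open ((\<lambda>\<zeta>. a + \<zeta> *s w) -` {z \<in> U. u z < c})"
        by (intro open_vimage open_usc_sublevel U usc continuous_intros)
      moreover have "(\<lambda>\<zeta>. a + \<zeta> *s w) -` {z \<in> U. u z < c} = {\<zeta> \<in> ?T. u (a + \<zeta> *s w) < c}" by auto
      ultimately show "openin (top_of_set ?T) {\<zeta> \<in> ?T. u (a + \<zeta> *s w) < c}"
        by (intro open_subset) auto
    qed
    show "u (a + \<zeta> *s w) < \<infinity>" if "\<zeta> \<in> ?T" for \<zeta> using that fin(1) by simp
    fix p :: complex and r :: real assume r: "0 < r" and s: "cball p r \<subseteq> ?T"
    have "u (a + p *s w) \<le> circle_mean (\<lambda>\<zeta>. u ((a + p *s w) + \<zeta> *s (r *\<^sub>R w))) 0 1"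
    proof (rule sub)
      fix \<zeta> :: complex assume "norm \<zeta> \<le> 1"
      then have "p + of_real r * \<zeta> \<in> cball p r" using r by (simp add: dist_norm norm_mult)
      then have "a + (p + of_real r * \<zeta>) *s w \<in> U" using s by blast
      moreover have "a + (p + of_real r * \<zeta>) *s w = a + p *s w + \<zeta> *s (r *\<^sub>R w)"
        unfolding of_real_smult[symmetric] by (simp add: vec_eq_iff algebra_simps)
      ultimately show "a + p *s w + \<zeta> *s (r *\<^sub>R w) \<in> U" by (simp only:)
    qed
    then show "u (a + p *s w) \<le> circle_mean (\<lambda>\<zeta>. u (a + \<zeta> *s w)) p r"
      by (subst circle_mean_on_line)
  qed
qed (use usc fin in auto)

lemma PSH_D:
  fixes u :: "complex ^ 'n \<Rightarrow> ereal"
  assumes "u \<in> PSH U" "\<And>\<zeta>. norm \<zeta> \<le> 1 \<Longrightarrow> z + \<zeta> *s v \<in> U"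
  shows "u z \<le> circle_mean (\<lambda>\<zeta>. u (z + \<zeta> *s v)) 0 1"
proof -
  have s: "subharmonic_on {\<zeta>. z + \<zeta> *s v \<in> U} (\<lambda>\<zeta>. u (z + \<zeta> *s v))"
    using assms(1) by (simp add: PSH_def)
  have "0 < (1::real) \<and> cball 0 1 \<subseteq> {\<zeta>. z + \<zeta> *s v \<in> U}" using assms(2) by auto
  from conjunct2[OF conjunct2[OF s[unfolded subharmonic_on_def]], THEN spec, THEN spec, THEN mp, OF this]
  have "u (z + 0 *s v) \<le> circle_mean (\<lambda>\<zeta>. u (z + \<zeta> *s v)) 0 1" .
  then show ?thesis by simp
qed

text \<open>Continuous plurisubharmonicity for real-valued functions, in the normal form where radius and
direction of a disc are merged into the vector \<open>v\<close>.\<close>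
definition cont_psh :: "(complex ^ 'n) set \<Rightarrow> (complex ^ 'n \<Rightarrow> real) \<Rightarrow> bool" where
  "cont_psh U u \<longleftrightarrow> continuous_on U u \<and>
    (\<forall>z v. (\<forall>\<zeta>. norm \<zeta> \<le> 1 \<longrightarrow> z + \<zeta> *s v \<in> U) \<longrightarrow> u z \<le> circle_avg (\<lambda>\<omega>. u (z + \<omega> *s v)))"

lemma continuous_on_line:
  fixes u :: "complex ^ 'n \<Rightarrow> real"
  assumes "continuous_on U u" "\<And>\<zeta>. \<zeta> \<in> T \<Longrightarrow> z + \<zeta> *s v \<in> U"
  shows "continuous_on T (\<lambda>\<zeta>. u (z + \<zeta> *s v))"
  by (rule continuous_on_compose2[OF assms(1)]) (use assms(2) in \<open>auto intro!: continuous_intros\<close>)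

lemma cont_psh_imp_PSH:
  fixes u :: "complex ^ 'n \<Rightarrow> real"
  assumes U: "open U" and u: "cont_psh U u"
  shows "(\<lambda>z. ereal (u z)) \<in> PSH U"
proof (rule PSH_I[OF U])
  have cont: "continuous_on U u" using u by (simp add: cont_psh_def)
  show "usc_on U (\<lambda>z. ereal (u z))"
    unfolding usc_on_def
  proof
    fix c
    have "open (U \<inter> (\<lambda>z. ereal (u z)) -` {..<c})"
      by (intro continuous_open_preimage U continuous_on_ereal cont) auto
    moreover have "U \<inter> (\<lambda>z. ereal (u z)) -` {..<c} = {z \<in> U. ereal (u z) < c}" by auto
    ultimately show "openin (top_of_set U) {z \<in> U. ereal (u z) < c}" by (simp add: open_subset)
  qed
  fix z v assume d: "\<And>\<zeta>. norm \<zeta> \<le> 1 \<Longrightarrow> z + \<zeta> *s v \<in> U"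
  have c: "continuous_on (sphere 0 1) (\<lambda>\<zeta>. u (z + \<zeta> *s v))"
    by (rule continuous_on_line[OF cont]) (use d in simp)
  then have "circle_mean (\<lambda>\<zeta>. ereal (u (z + \<zeta> *s v))) 0 1 = ereal (circle_avg (\<lambda>\<omega>. u (z + \<omega> *s v)))"
    using circle_mean_real[of "\<lambda>\<zeta>. u (z + \<zeta> *s v)" 0 1] by simp
  then show "ereal (u z) \<le> circle_mean (\<lambda>\<zeta>. ereal (u (z + \<zeta> *s v))) 0 1"
    using u d by (simp add: cont_psh_def)
qed auto

section \<open>Second differences of plurisubharmonic functions\<close>

lemma disc_reflection_mem:
  fixes m :: "complex ^ 'n"
  assumes "\<And>\<zeta>. norm \<zeta> \<le> 1 \<Longrightarrow> m + \<zeta> *s v \<in> U" "norm \<zeta> \<le> 1"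
  shows "m - \<zeta> *s v \<in> U"
  using assms(1)[of "-\<zeta>"] assms(2) by (simp add: vector_sneg_minus1[symmetric] vector_smult_lneg)

text \<open>With \<open>g = 2 A |z|^2 - f\<close>, which is convex by \<open>upper\<close>, let \<open>E w\<close> be half the second difference of
\<open>g\<close> at \<open>m\<close> in direction \<open>w\<close>. It is convex, even and vanishes at 0, hence increases along rays, and the
sub-mean value inequality for \<open>f\<close> bounds its average over \<open>\<omega> v\<close>. For \<open>\<omega> = cos t + i sin t\<close> one has
\<open>h = cos t (\<omega> h) + sin t (- i \<omega> h)\<close>, that is, \<open>h\<close> is the midpoint of \<open>cos t (\<omega> 2h)\<close> and
\<open>sin t (- i \<omega> 2h)\<close>. So \<open>2 E h \<le> E (\<omega> 2h) + E (- i \<omega> 2h)\<close> for every \<open>\<omega>\<close>, and averaging over the circle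
bounds \<open>E h\<close> itself.\<close>
lemma second_difference_lower_bound:
  fixes f :: "complex ^ 'n \<Rightarrow> real"
  assumes U: "convex U" and f: "cont_psh U f"
    and upper: "\<And>x y. x \<in> U \<Longrightarrow> y \<in> U \<Longrightarrow> f x + f y - 2 * f (midpoint x y) \<le> A * (norm (x - y))\<^sup>2"
    and A: "0 \<le> A" 
    and disc: "\<And>\<zeta>. norm \<zeta> \<le> 2 \<Longrightarrow> m + \<zeta> *s h \<in> U"
  shows "- 12 * A * (norm h)\<^sup>2 \<le> f (m + h) + f (m - h) - 2 * f m"
proof -
  define g where "g = (\<lambda>z. 2 * A * (norm z)\<^sup>2 - f z)"
  have cf: "continuous_on U f" using f by (simp add: cont_psh_def)
  have g: "convex_on U g"
  proof (rule midpoint_convex_imp_convex_on[OF U])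
    show "continuous_on U g" unfolding g_def by (intro continuous_intros cf)
    show "2 * g (midpoint x y) \<le> g x + g y" if "x \<in> U" "y \<in> U" for x y
    proof -
      have "2 * A * ((norm x)\<^sup>2 + (norm y)\<^sup>2 - 2 * (norm (midpoint x y))\<^sup>2) = A * (norm (x - y))\<^sup>2"
        unfolding norm_sq_midpoint by simp
      then show ?thesis using upper[OF that] by (simp add: g_def algebra_simps)
    qed
  qed
  define E where "E = (\<lambda>w. (g (m + w) + g (m - w)) / 2 - g m)"
  have E_f: "E w = 2 * A * (norm w)\<^sup>2 - (f (m + w) + f (m - w)) / 2 + f m" for w
  proof -
    have "(norm (m + w))\<^sup>2 + (norm (m - w))\<^sup>2 = 2 * (norm m)\<^sup>2 + 2 * (norm w)\<^sup>2"
      by (simp add: power2_norm_eq_inner inner_add inner_diff inner_commute)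
    then have "A * (norm (m + w))\<^sup>2 + A * (norm (m - w))\<^sup>2 = 2 * A * (norm m)\<^sup>2 + 2 * A * (norm w)\<^sup>2"
      unfolding distrib_left[symmetric] by (simp add: algebra_simps)
    then show ?thesis by (simp add: E_def g_def field_simps)
  qed
  have seg: "m + c *\<^sub>R w = (1 - (1 + c) / 2) *\<^sub>R (m - w) + ((1 + c) / 2) *\<^sub>R (m + w)"
    "m - c *\<^sub>R w = (1 - (1 + c) / 2) *\<^sub>R (m + w) + ((1 + c) / 2) *\<^sub>R (m - w)" for c w
  proof -
    define s where "s = (1 + c) / 2"
    have c: "c = 2 * s - 1" by (simp add: s_def field_simps)
    show "m + c *\<^sub>R w = (1 - (1 + c) / 2) *\<^sub>R (m - w) + ((1 + c) / 2) *\<^sub>R (m + w)"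
      unfolding s_def[symmetric] c by (simp add: algebra_simps flip: scaleR_2)
    show "m - c *\<^sub>R w = (1 - (1 + c) / 2) *\<^sub>R (m + w) + ((1 + c) / 2) *\<^sub>R (m - w)"
      unfolding s_def[symmetric] c by (simp add: algebra_simps flip: scaleR_2)
  qed
  \<comment> \<open>\<open>m + c w\<close> and \<open>m - c w\<close> are complementary convex combinations of \<open>m + w\<close> and \<open>m - w\<close>.\<close>
  have E_shrink: "E (c *\<^sub>R w) \<le> E w" if w: "m + w \<in> U" "m - w \<in> U" and c: "\<bar>c\<bar> \<le> 1" for c w
  proof -
    define s where "s = (1 + c) / 2"
    have s: "0 \<le> s" "s \<le> 1" using c by (auto simp: s_def)
    note seg' = seg[of c w, folded s_def]
    have "g (m + c *\<^sub>R w) \<le> (1 - s) * g (m - w) + s * g (m + w)"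
      "g (m - c *\<^sub>R w) \<le> (1 - s) * g (m + w) + s * g (m - w)"
      unfolding seg' using convex_onD[OF g s w(2) w(1)] convex_onD[OF g s w] by simp_all
    then have "g (m + c *\<^sub>R w) + g (m - c *\<^sub>R w) \<le> g (m + w) + g (m - w)"
      by (simp add: algebra_simps)
    then show ?thesis by (simp add: E_def)
  qed
  have E_mid: "2 * E (midpoint w1 w2) \<le> E w1 + E w2"
    if "m + w1 \<in> U" "m - w1 \<in> U" "m + w2 \<in> U" "m - w2 \<in> U" for w1 w2
  proof -
    have "(1/2) *\<^sub>R ((m + w1) + (m + w2)) = (1/2) *\<^sub>R (m + m) + midpoint w1 w2"
      "(1/2) *\<^sub>R ((m - w1) + (m - w2)) = (1/2) *\<^sub>R (m + m) - midpoint w1 w2"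
      by (simp_all only: midpoint_def scaleR_add_right scaleR_diff_right) simp_all
    then have "m + midpoint w1 w2 = (1 - 1/2) *\<^sub>R (m + w1) + (1/2) *\<^sub>R (m + w2)"
      "m - midpoint w1 w2 = (1 - 1/2) *\<^sub>R (m - w1) + (1/2) *\<^sub>R (m - w2)"
      by (simp_all only: scaleR_half_double) (simp_all only: scaleR_add_right, simp_all)
    moreover have "g ((1 - 1/2) *\<^sub>R (m + w1) + (1/2) *\<^sub>R (m + w2)) \<le> (1 - 1/2) * g (m + w1) + (1/2) * g (m + w2)"
      "g ((1 - 1/2) *\<^sub>R (m - w1) + (1/2) *\<^sub>R (m - w2)) \<le> (1 - 1/2) * g (m - w1) + (1/2) * g (m - w2)"
      by (rule convex_onD[OF g]; use that in simp)+
    ultimately have "g (m + midpoint w1 w2) \<le> (1 - 1/2) * g (m + w1) + (1/2) * g (m + w2)"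
      "g (m - midpoint w1 w2) \<le> (1 - 1/2) * g (m - w1) + (1/2) * g (m - w2)"
      by (simp_all only:)
    then show ?thesis by (simp add: E_def field_simps)
  qed
  have E_cont: "continuous_on (sphere 0 1) (\<lambda>\<omega>. E (\<omega> *s v))"
    if v: "\<And>\<zeta>. norm \<zeta> \<le> 1 \<Longrightarrow> m + \<zeta> *s v \<in> U" for v
    unfolding E_f
    by (intro continuous_intros continuous_on_compose2[OF cf]) (use v disc_reflection_mem[OF v] in auto)
  have E_avg: "circle_avg (\<lambda>\<omega>. E (\<omega> *s v)) \<le> 2 * A * (norm v)\<^sup>2"
    if v: "\<And>\<zeta>. norm \<zeta> \<le> 1 \<Longrightarrow> m + \<zeta> *s v \<in> U" for v
  proof -
    have v': "m + \<zeta> *s (- v) \<in> U" if "norm \<zeta> \<le> 1" for \<zeta>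
      using disc_reflection_mem[OF v that] by simp
    define F1 F2 where "F1 = (\<lambda>\<omega>. f (m + \<omega> *s v))" and "F2 = (\<lambda>\<omega>. f (m + \<omega> *s (- v)))"
    have c: "continuous_on (sphere 0 1) F1" "continuous_on (sphere 0 1) F2"
      unfolding F1_def F2_def by (rule continuous_on_line[OF cf], use v v' in simp)+
    have "circle_avg (\<lambda>\<omega>. E (\<omega> *s v)) =
      circle_avg (\<lambda>\<omega>. (2 * A * (norm v)\<^sup>2 + f m) - (1/2) * (F1 \<omega> + F2 \<omega>))"
      by (rule circle_avg_cong) (simp add: E_f norm_vector_smult F1_def F2_def)
    also have "\<dots> = circle_avg (\<lambda>\<omega>. 2 * A * (norm v)\<^sup>2 + f m) - circle_avg (\<lambda>\<omega>. (1/2) * (F1 \<omega> + F2 \<omega>))"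
      by (intro circle_avg_diff continuous_intros c)
    also have "\<dots> = (2 * A * (norm v)\<^sup>2 + f m) - (1/2) * (circle_avg F1 + circle_avg F2)"
      by (simp only: circle_avg_const circle_avg_cmul circle_avg_add[OF c])
    also have "\<dots> \<le> 2 * A * (norm v)\<^sup>2"
    proof -
      have "f m \<le> circle_avg F1" "f m \<le> circle_avg F2"
        using f v v' unfolding cont_psh_def F1_def F2_def by blast+
      then have "2 * f m \<le> circle_avg F1 + circle_avg F2" by linarith
      then show ?thesis by simp
    qed
    finally show ?thesis .
  qed
  have d1: "m + \<zeta> *s (2 *\<^sub>R h) \<in> U" if "norm \<zeta> \<le> 1" for \<zeta>
    unfolding of_real_smult[symmetric] vector_smult_assoc
    by (rule disc) (use that in \<open>simp add: norm_mult\<close>)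
  have d2: "m + \<zeta> *s ((- \<i>) *s (2 *\<^sub>R h)) \<in> U" if "norm \<zeta> \<le> 1" for \<zeta>
    unfolding vector_smult_assoc by (rule d1) (use that in \<open>simp add: norm_mult\<close>)
  let ?F = "\<lambda>\<omega>. E (\<omega> *s (2 *\<^sub>R h))" and ?G = "\<lambda>\<omega>. E (\<omega> *s ((- \<i>) *s (2 *\<^sub>R h)))"
  have pt: "2 * E h \<le> ?F \<omega> + ?G \<omega>" if w: "norm \<omega> = 1" for \<omega>
  proof -
    let ?a = "\<omega> *s (2 *\<^sub>R h)" and ?b = "\<omega> *s ((- \<i>) *s (2 *\<^sub>R h))"
    have ab: "m + ?a \<in> U" "m - ?a \<in> U" "m + ?b \<in> U" "m - ?b \<in> U"
      using d1[of \<omega>] d2[of \<omega>] disc_reflection_mem[OF d1, of \<omega>] disc_reflection_mem[OF d2, of \<omega>] w by auto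
    have c: "\<bar>Re \<omega>\<bar> \<le> 1" "\<bar>Im \<omega>\<bar> \<le> 1"
      using abs_Re_le_cmod[of \<omega>] abs_Im_le_cmod[of \<omega>] w by auto
    have in_seg: "m + c *\<^sub>R w \<in> U \<and> m - c *\<^sub>R w \<in> U" if "m + w \<in> U" "m - w \<in> U" "\<bar>c\<bar> \<le> 1" for c w
    proof -
      show ?thesis unfolding seg using that by (auto intro!: convexD_alt[OF U])
    qed
    have "midpoint (Re \<omega> *\<^sub>R ?a) (Im \<omega> *\<^sub>R ?b) = h"
    proof -
      have "Re \<omega> * \<omega> - Im \<omega> * \<i> * \<omega> = 1"
      proof -
        have "Re \<omega> * \<omega> - Im \<omega> * \<i> * \<omega> = cnj \<omega> * \<omega>"
          by (simp add: complex_eq_iff algebra_simps)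
        then show ?thesis using w by (simp add: complex_norm_square[symmetric] mult.commute)
      qed
      then have "Re \<omega> * \<omega> * h $ i - Im \<omega> * \<i> * \<omega> * h $ i = h $ i" for i
        by (metis left_diff_distrib mult_1)
      then show ?thesis
        by (simp add: midpoint_def vec_eq_iff) (simp add: scaleR_conv_of_real algebra_simps)
    qed
    then have "2 * E h \<le> E (Re \<omega> *\<^sub>R ?a) + E (Im \<omega> *\<^sub>R ?b)"
      using E_mid[of "Re \<omega> *\<^sub>R ?a" "Im \<omega> *\<^sub>R ?b"] in_seg[OF ab(1,2) c(1)] in_seg[OF ab(3,4) c(2)] by simp
    also have "\<dots> \<le> E ?a + E ?b"
      by (intro add_mono E_shrink ab c)
    finally show ?thesis .
  qed
  have cF: "continuous_on (sphere 0 1) ?F" by (rule E_cont[OF d1])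
  have cG: "continuous_on (sphere 0 1) ?G" by (rule E_cont[OF d2])
  have "2 * E h = circle_avg (\<lambda>\<omega>. 2 * E h)" by (rule circle_avg_const[symmetric])
  also have "\<dots> \<le> circle_avg (\<lambda>\<omega>. ?F \<omega> + ?G \<omega>)"
    by (rule circle_avg_mono[OF continuous_on_const continuous_on_add[OF cF cG] pt])
  also have "\<dots> = circle_avg ?F + circle_avg ?G"
    by (rule circle_avg_add[OF cF cG])
  also have "\<dots> \<le> 2 * A * (norm (2 *\<^sub>R h))\<^sup>2 + 2 * A * (norm ((- \<i>) *s (2 *\<^sub>R h)))\<^sup>2"
    by (intro add_mono E_avg d1 d2)
  finally have "E h \<le> 8 * A * (norm h)\<^sup>2"
    by (simp add: norm_vector_smult power_mult_distrib)
  moreover define X where "X = A * (norm h)\<^sup>2"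
  ultimately have "f m - (f (m + h) + f (m - h)) / 2 \<le> 6 * X"
    unfolding E_f by simp
  then have "- 12 * X \<le> f (m + h) + f (m - h) - 2 * f m" by (simp add: field_simps)
  then show ?thesis by (simp add: X_def)
qed

section \<open>Projective self-maps of the ball\<close>

text \<open>The standard Hermitian form; it is conjugate linear in the second argument.\<close>
definition herm :: "complex ^ 'n \<Rightarrow> complex ^ 'n \<Rightarrow> complex" where
  "herm z a = (\<Sum>i\<in>UNIV. z $ i * cnj (a $ i))"

lemma herm_add_left: "herm (z + w) a = herm z a + herm w a"
  and herm_smult_left: "herm (c *s z) a = c * herm z a"
  and herm_minus_right: "herm z (- a) = - herm z a"
  by (simp_all add: herm_def sum.distrib distrib_right sum_distrib_left mult.assoc sum_negf)

lemma herm_add_right: "herm z (a + b) = herm z a + herm z b"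
  and herm_smult_right: "herm z (c *s a) = cnj c * herm z a"
  by (simp_all add: herm_def sum.distrib distrib_left sum_distrib_left mult.left_commute)

lemma herm_self: "herm z z = of_real ((norm z)\<^sup>2)"
  unfolding herm_def norm_vec_def L2_set_def
  by (simp only: real_sqrt_pow2[OF sum_nonneg] zero_le_power2 of_real_sum complex_norm_square)

lemma norm_herm_le: "norm (herm z a) \<le> norm z * norm a"
proof -
  have "norm (herm z a) \<le> (\<Sum>i\<in>UNIV. norm (z $ i * cnj (a $ i)))"
    unfolding herm_def by (rule norm_sum)
  also have "\<dots> = (\<Sum>i\<in>UNIV. \<bar>norm (z $ i)\<bar> * \<bar>norm (a $ i)\<bar>)" by (simp add: norm_mult)
  also have "\<dots> \<le> L2_set (\<lambda>i. norm (z $ i)) UNIV * L2_set (\<lambda>i. norm (a $ i)) UNIV"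
    by (rule L2_set_mult_ineq)
  finally show ?thesis by (simp add: norm_vec_def)
qed

lemma Re_herm: "Re (herm z a) = z \<bullet> a"
  by (simp add: herm_def inner_vec_def inner_complex_def)

lemma continuous_on_herm [continuous_intros]:
  "continuous_on S f \<Longrightarrow> continuous_on S (\<lambda>z. herm (f z) a)"
  unfolding herm_def by (intro continuous_intros)

lemma continuous_on_smult_both [continuous_intros]:
  fixes f :: "'a::topological_space \<Rightarrow> complex" and g :: "'a \<Rightarrow> complex ^ 'n"
  assumes "continuous_on S f" "continuous_on S g"
  shows "continuous_on S (\<lambda>z. f z *s g z)"
  unfolding vector_scalar_mult_def using assms by (intro continuous_intros)

text \<open>A stand-in for the automorphisms of the ball, without square roots. Up to second order in \<open>a\<close> it is
the flow of the vector field \<open>z \<mapsto> a - herm z a *s z\<close>, which is tangent to the unit sphere. The real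
factor compensates the quadratic amount by which \<open>(z + a) / (1 + herm z a)\<close> may leave the ball.\<close>
definition ball_map :: "complex ^ 'n \<Rightarrow> complex ^ 'n \<Rightarrow> complex ^ 'n" where
  "ball_map a z = (of_real (1 / (1 + 4 * (norm a)\<^sup>2)) / (1 + herm z a)) *s (z + a)"

lemma norm_one_plus_herm:
  assumes "norm a \<le> 1/2" "norm z \<le> 1"
  shows "1/2 \<le> norm (1 + herm z a)"
proof -
  have "norm (herm z a) \<le> 1 * (1/2)"
    using norm_herm_le[of z a] mult_mono[OF assms(2,1)] by simp
  moreover have "1 - norm (herm z a) \<le> norm (1 + herm z a)"
    using norm_triangle_ineq4[of "1 + herm z a" "herm z a"] by simp
  ultimately show ?thesis by simp
qed

text \<open>The identity \<open>|1 + b|^2 - |z + a|^2 = (1 - |z|^2) + |b|^2 - |a|^2\<close> with \<open>b = herm z a\<close> shows that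
\<open>|z + a|^2\<close> exceeds \<open>|1 + b|^2\<close> by less than \<open>|a|^2 \<le> 4 |a|^2 |1 + b|^2\<close>.\<close>
lemma ball_map_in_ball:
  assumes a: "norm a \<le> 1/2" and z: "norm z < 1"
  shows "norm (ball_map a z) < 1"
proof -
  define b where "b = herm z a"
  define D where "D = norm (1 + b)"
  define k where "k = 1 + 4 * (norm a)\<^sup>2"
  have k: "1 \<le> k" by (simp add: k_def)
  have D: "1/2 \<le> D" using norm_one_plus_herm[OF a] z by (simp add: D_def b_def)
  have "D\<^sup>2 = 1 + 2 * Re b + (norm b)\<^sup>2"
    unfolding D_def cmod_power2 by (simp add: power2_eq_square algebra_simps)
  moreover have "(norm (z + a))\<^sup>2 = (norm z)\<^sup>2 + 2 * Re b + (norm a)\<^sup>2"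
    by (simp add: power2_norm_eq_inner inner_add inner_commute b_def Re_herm)
  moreover have "(norm z)\<^sup>2 < 1" using z by (simp add: power_less_one_iff)
  ultimately have "(norm (z + a))\<^sup>2 < D\<^sup>2 + (norm a)\<^sup>2"
    using zero_le_power2[of "norm b"] by linarith
  also have "\<dots> \<le> D\<^sup>2 * k"
  proof -
    have "1/4 \<le> D\<^sup>2" using power_mono[OF D, of 2] by (simp add: power2_eq_square)
    from mult_right_mono[OF this, of "4 * (norm a)\<^sup>2"] show ?thesis by (simp add: k_def algebra_simps)
  qed
  also have "\<dots> \<le> (D * k)\<^sup>2"
  proof -
    have "0 \<le> D\<^sup>2 * k" using k by simp
    from mult_left_mono[OF k this] show ?thesis by (simp add: power2_eq_square mult_ac)
  qed
  finally have "norm (z + a) < D * k"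
    by (rule power_less_imp_less_base) (use D k in simp)
  moreover have "norm (ball_map a z) = norm (z + a) / (D * k)"
    unfolding ball_map_def norm_vector_smult
    using k by (simp add: norm_divide norm_mult D_def b_def k_def[symmetric])
  moreover have "0 < D * k" using D k by simp
  ultimately show ?thesis by simp
qed

lemma ball_map_scaled_error:
  assumes "1 + herm z a \<noteq> 0"
  shows "(1 + herm z a) *s (ball_map a z - w) =
    of_real (1 / (1 + 4 * (norm a)\<^sup>2)) *s (z + a) - (1 + herm z a) *s w"
  using assms by (simp add: ball_map_def vector_ssub_ldistrib vector_smult_assoc)

lemma ball_map_expansion:
  assumes a: "norm a \<le> 1/2" and z: "norm z \<le> 1"
  shows "norm (ball_map a z - z) \<le> 8 * norm a"
    and "norm (ball_map a z - (z + a - herm z a *s z)) \<le> 16 * (norm a)\<^sup>2"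
proof -
  define b where "b = herm z a"
  define c where "c = 1 / (1 + 4 * (norm a)\<^sup>2)"
  have half: "1/2 \<le> norm (1 + b)" using norm_one_plus_herm[OF a z] by (simp add: b_def)
  then have nz: "1 + herm z a \<noteq> 0" by (auto simp: b_def)
  have c: "0 \<le> c" "c \<le> 1" "1 - c \<le> 4 * (norm a)\<^sup>2"
  proof -
    define t where "t = 4 * (norm a)\<^sup>2"
    have t: "0 \<le> t" by (simp add: t_def)
    have "(1 - t) * (1 + t) \<le> 1" by (simp add: algebra_simps)
    then have "1 - t \<le> 1 / (1 + t)" using t by (subst pos_le_divide_eq) auto
    moreover have ct: "c = 1 / (1 + t)" by (simp add: c_def t_def)
    ultimately show "1 - c \<le> 4 * (norm a)\<^sup>2" unfolding t_def by linarith
    show "0 \<le> c" "c \<le> 1" using t by (simp_all add: ct)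
  qed
  have b: "norm b \<le> norm a"
    using norm_herm_le[of z a] mult_right_mono[OF z, of "norm a"] by (simp add: b_def)
  have a2: "4 * (norm a)\<^sup>2 \<le> 2 * norm a"
    using mult_right_mono[OF a, of "norm a"] by (simp add: power2_eq_square)
  have upper: "norm x \<le> 2 * M" if "norm ((1 + b) *s x) \<le> M" for x :: "complex ^ 'a" and M
  proof -
    have "1/2 * norm x \<le> norm (1 + b) * norm x" by (intro mult_right_mono half) simp
    also have "\<dots> \<le> M" using that by (simp only: norm_vector_smult)
    finally show ?thesis by simp
  qed
  have cz: "norm (of_real (c - 1) *s x) \<le> 4 * (norm a)\<^sup>2 * norm x" for x :: "complex ^ 'a"
  proof -
    have "norm (of_real (c - 1) *s x) = (1 - c) * norm x"
      unfolding norm_vector_smult norm_of_real using c by simp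
    then show ?thesis using c(3) by (simp add: mult_right_mono)
  qed
  have "norm (ball_map a z - z) \<le> 2 * (4 * norm a)"
  proof (rule upper)
    have "(1 + b) *s (ball_map a z - z) = of_real (c - 1) *s z + of_real c *s a - b *s z"
      unfolding b_def ball_map_scaled_error[OF nz] c_def[symmetric]
      by (simp add: vec_eq_iff algebra_simps)
    also have "norm \<dots> \<le> norm (of_real (c - 1) *s z) + norm (complex_of_real c *s a) + norm (b *s z)"
      by (rule order_trans[OF norm_triangle_ineq4 add_right_mono[OF norm_triangle_ineq]])
    also have "\<dots> \<le> 4 * (norm a)\<^sup>2 * 1 + 1 * norm a + norm a * 1"
    proof (intro add_mono)
      show "norm (of_real (c - 1) *s z) \<le> 4 * (norm a)\<^sup>2 * 1"
        using cz[of z] mult_left_mono[OF z, of "4 * (norm a)\<^sup>2"] by simp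
      show "norm (complex_of_real c *s a) \<le> 1 * norm a"
        using c by (simp add: norm_vector_smult mult_left_le_one_le)
      show "norm (b *s z) \<le> norm a * 1"
        unfolding norm_vector_smult by (intro mult_mono b z) auto
    qed
    finally show "norm ((1 + b) *s (ball_map a z - z)) \<le> 4 * norm a" using a2 by simp
  qed
  then show "norm (ball_map a z - z) \<le> 8 * norm a" by simp
  have "norm (ball_map a z - (z + a - b *s z)) \<le> 2 * (8 * (norm a)\<^sup>2)"
  proof (rule upper)
    have "(1 + b) *s (ball_map a z - (z + a - b *s z)) = of_real (c - 1) *s (z + a) - b *s (a - b *s z)"
      unfolding b_def ball_map_scaled_error[OF nz] c_def[symmetric]
      by (simp add: vec_eq_iff algebra_simps)
    also have "norm \<dots> \<le> norm (of_real (c - 1) *s (z + a)) + norm (b *s (a - b *s z))"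
      by (rule norm_triangle_ineq4)
    also have "\<dots> \<le> 4 * (norm a)\<^sup>2 * (3/2) + norm a * (norm a + norm a)"
    proof (intro add_mono)
      have "norm (z + a) \<le> 3/2" using norm_triangle_ineq[of z a] a z by simp
      then show "norm (of_real (c - 1) *s (z + a)) \<le> 4 * (norm a)\<^sup>2 * (3/2)"
        by (intro order_trans[OF cz] mult_left_mono) auto
      have "norm (b *s z) \<le> norm a * 1"
        unfolding norm_vector_smult by (intro mult_mono b z) auto
      then have "norm (a - b *s z) \<le> norm a + norm a"
        using norm_triangle_ineq4[of a "b *s z"] by simp
      then show "norm (b *s (a - b *s z)) \<le> norm a * (norm a + norm a)"
        unfolding norm_vector_smult by (intro mult_mono b) auto
    qed
    finally show "norm ((1 + b) *s (ball_map a z - (z + a - b *s z))) \<le> 8 * (norm a)\<^sup>2"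
      by (simp add: power2_eq_square)
  qed
  then show "norm (ball_map a z - (z + a - herm z a *s z)) \<le> 16 * (norm a)\<^sup>2" by (simp add: b_def)
qed

lemma ball_map_symmetric_second_order:
  assumes a: "norm a \<le> 1/2" and z: "norm z \<le> 1"
  shows "norm ((ball_map a z - z) + (ball_map (- a) z - z)) \<le> 32 * (norm a)\<^sup>2"
proof -
  have "(ball_map a z - z) + (ball_map (- a) z - z) =
    (ball_map a z - (z + a - herm z a *s z)) + (ball_map (- a) z - (z + (- a) - herm z (- a) *s z))"
    by (simp add: herm_minus_right vector_smult_lneg)
  also have "norm \<dots> \<le> 16 * (norm a)\<^sup>2 + 16 * (norm (- a))\<^sup>2"
    by (rule norm_triangle_mono) (use ball_map_expansion(2)[of a z] ball_map_expansion(2)[of "- a" z] assms in simp)+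
  finally show ?thesis by simp
qed

text \<open>On a line the map has the form \<open>(p + \<zeta> q) / (1 + cnj \<sigma> \<zeta>)\<close>, where \<open>|\<sigma>| < 1\<close> because the denominator
has no zero in the closed disc. The vectors \<open>P\<close> and \<open>V\<close> solve \<open>P + \<sigma> V = p\<close> and \<open>cnj \<sigma> P + V = q\<close>, a
system with determinant \<open>1 - |\<sigma>|^2\<close>.\<close>
lemma ball_map_on_line:
  fixes z v a :: "complex ^ 'n"
  assumes nz: "\<And>\<zeta>. norm \<zeta> \<le> 1 \<Longrightarrow> 1 + herm (z + \<zeta> *s v) a \<noteq> 0"
  obtains \<sigma> P V where "norm \<sigma> < 1"
    "\<And>\<zeta>. norm \<zeta> \<le> 1 \<Longrightarrow> ball_map a (z + \<zeta> *s v) = P + disc_moebius \<sigma> \<zeta> *s V"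
proof -
  define \<alpha> where "\<alpha> = 1 + herm z a"
  define \<beta> where "\<beta> = herm v a"
  define c where "c = complex_of_real (1 / (1 + 4 * (norm a)\<^sup>2))"
  have den: "1 + herm (z + \<zeta> *s v) a = \<alpha> + \<beta> * \<zeta>" for \<zeta>
    by (simp add: \<alpha>_def \<beta>_def herm_add_left herm_smult_left mult.commute)
  have \<alpha>: "\<alpha> \<noteq> 0" using nz[of 0] by (simp add: \<alpha>_def)
  define \<sigma> where "\<sigma> = cnj (\<beta> / \<alpha>)"
  have \<sigma>: "norm \<sigma> < 1"
  proof (rule ccontr)
    assume "\<not> norm \<sigma> < 1"
    then have le: "norm \<alpha> \<le> norm \<beta>" using \<alpha> by (simp add: \<sigma>_def norm_divide field_simps)
    then have "\<beta> \<noteq> 0" using \<alpha> by auto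
    then have "\<alpha> + \<beta> * (- \<alpha> / \<beta>) = 0" and n: "norm (- \<alpha> / \<beta>) \<le> 1"
      using le by (simp_all add: norm_divide)
    then show False using nz[OF n] unfolding den by blast
  qed
  define s where "s = 1 - cnj \<sigma> * \<sigma>"
  have s: "s \<noteq> 0" using disc_moebius_denom[of "-\<sigma>" \<sigma>] \<sigma> by (simp add: s_def)
  define p where "p = (c / \<alpha>) *s (z + a)"
  define q where "q = (c / \<alpha>) *s v"
  define V where "V = (1 / s) *s (q - cnj \<sigma> *s p)"
  define P where "P = p - \<sigma> *s V"
  have PV1: "P + \<sigma> *s V = p" by (simp add: P_def)
  have PV2: "cnj \<sigma> *s P + V = q"
  proof -
    have "s *s V = q - cnj \<sigma> *s p" using s by (simp add: V_def vector_smult_assoc)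
    then show ?thesis
      by (simp add: P_def s_def vec_eq_iff algebra_simps)
  qed
  have "ball_map a (z + \<zeta> *s v) = P + disc_moebius \<sigma> \<zeta> *s V" if \<zeta>: "norm \<zeta> \<le> 1" for \<zeta>
  proof -
    let ?d = "1 + cnj \<sigma> * \<zeta>"
    have d: "?d \<noteq> 0" by (rule disc_moebius_denom[OF \<sigma> \<zeta>])
    have "\<alpha> + \<beta> * \<zeta> = \<alpha> * ?d" using \<alpha> by (simp add: \<sigma>_def field_simps)
    then have "ball_map a (z + \<zeta> *s v) = (c / (\<alpha> * ?d)) *s (z + \<zeta> *s v + a)"
      by (simp add: ball_map_def den c_def)
    also have "\<dots> = (1 / ?d) *s (p + \<zeta> *s q)"
      by (simp add: p_def q_def vec_eq_iff algebra_simps add_divide_distrib)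
    also have "p + \<zeta> *s q = ?d *s P + (\<zeta> + \<sigma>) *s V"
      unfolding PV1[symmetric] PV2[symmetric] by (simp add: vec_eq_iff algebra_simps)
    also have "(1 / ?d) *s (?d *s P + (\<zeta> + \<sigma>) *s V) = P + disc_moebius \<sigma> \<zeta> *s V"
      unfolding vector_add_ldistrib vector_smult_assoc disc_moebius_def using d by simp
    finally show ?thesis .
  qed
  then show ?thesis using that \<sigma> by blast
qed

text \<open>A disc in a complex line is mapped onto a disc in another complex line, where the parameters are
related by a disc automorphism; the image disc lies in the ball because the automorphism is onto.\<close>
lemma cont_psh_compose_ball_map:
  fixes u :: "complex ^ 'n \<Rightarrow> real"
  assumes u: "cont_psh (ball 0 1) u" and a: "norm a \<le> 1/2"
  shows "cont_psh (ball 0 1) (\<lambda>z. u (ball_map a z))"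
  unfolding cont_psh_def
proof (intro conjI allI impI)
  let ?B = "ball (0 :: complex ^ 'n) 1"
  have cu: "continuous_on ?B u" using u by (simp add: cont_psh_def)
  have maps: "ball_map a z \<in> ?B" if "z \<in> ?B" for z using ball_map_in_ball[OF a] that by simp
  have nz: "1 + herm z a \<noteq> 0" if "z \<in> ?B" for z
    using norm_one_plus_herm[OF a, of z] that by auto
  have cb: "continuous_on ?B (ball_map a)"
    unfolding ball_map_def using nz by (intro continuous_intros) auto
  show "continuous_on ?B (\<lambda>z. u (ball_map a z))"
    by (rule continuous_on_compose2[OF cu cb]) (use maps in auto)
  fix z v assume d: "\<forall>\<zeta>. norm \<zeta> \<le> 1 \<longrightarrow> z + \<zeta> *s v \<in> ?B"
  obtain \<sigma> P V where \<sigma>: "norm \<sigma> < 1"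
    and line: "\<And>\<zeta>. norm \<zeta> \<le> 1 \<Longrightarrow> ball_map a (z + \<zeta> *s v) = P + disc_moebius \<sigma> \<zeta> *s V"
    using ball_map_on_line[of z v a] nz d by blast
  have PV: "P + \<zeta> *s V \<in> ?B" if "norm \<zeta> \<le> 1" for \<zeta>
  proof -
    have "norm (disc_moebius (-\<sigma>) \<zeta>) \<le> 1" using norm_disc_moebius_le[of "-\<sigma>" \<zeta>] \<sigma> that by simp
    then have "ball_map a (z + disc_moebius (-\<sigma>) \<zeta> *s v) = P + \<zeta> *s V"
      using line disc_moebius_inverse[OF \<sigma> that] by simp
    then show ?thesis using maps d \<open>norm (disc_moebius (-\<sigma>) \<zeta>) \<le> 1\<close> by metis
  qed
  have "submean_disc (\<lambda>\<zeta>. u (P + \<zeta> *s V))"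
    unfolding submean_disc_def
  proof (intro conjI allI impI; (elim conjE)?)
    show "continuous_on (cball 0 1) (\<lambda>\<zeta>. u (P + \<zeta> *s V))"
      by (rule continuous_on_line[OF cu]) (use PV in simp)
    fix p :: complex and r :: real assume r: "0 < r" and sub: "cball p r \<subseteq> cball 0 1"
    have eq: "P + (p + of_real r * \<zeta>) *s V = (P + p *s V) + \<zeta> *s (of_real r *s V)" for \<zeta>
      by (simp add: vec_eq_iff algebra_simps)
    have "(P + p *s V) + \<zeta> *s (of_real r *s V) \<in> ?B" if "norm \<zeta> \<le> 1" for \<zeta>
    proof -
      have "p + of_real r * \<zeta> \<in> cball p r" using r that by (simp add: dist_norm norm_mult)
      then have "norm (p + of_real r * \<zeta>) \<le> 1" using sub by (metis dist_0_norm mem_cball subsetD)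
      then show ?thesis using PV eq by metis
    qed
    then show "u (P + p *s V) \<le> circle_avg (\<lambda>\<omega>. u (P + (p + of_real r * \<omega>) *s V))"
      unfolding eq using u unfolding cont_psh_def by blast
  qed
  from submean_moebius[OF this \<sigma>]
  have "u (P + \<sigma> *s V) \<le> circle_avg (\<lambda>\<omega>. u (P + disc_moebius \<sigma> \<omega> *s V))" .
  also have "\<dots> = circle_avg (\<lambda>\<omega>. u (ball_map a (z + \<omega> *s v)))"
    by (rule circle_avg_cong) (simp add: line)
  also have "P + \<sigma> *s V = ball_map a z" using line[of 0] by (simp add: disc_moebius_def)
  finally show "u (ball_map a z) \<le> circle_avg (\<lambda>\<omega>. u (ball_map a (z + \<omega> *s v)))" .
qed

section \<open>The envelope of a bounded Lipschitz obstacle\<close>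

text \<open>The estimate for second differences allows two independent increments, because the images of a point
under opposite ball maps are symmetric about it only up to second order.\<close>
lemma C11_ball_bounds:
  fixes \<psi> :: "'a::real_normed_vector \<Rightarrow> real"
  assumes "C11_closure (ball 0 1) \<psi>"
  obtains M \<Lambda> L where "0 \<le> M" "0 \<le> \<Lambda>" "0 \<le> L"
    "\<And>x. x \<in> ball 0 1 \<Longrightarrow> \<bar>\<psi> x\<bar> \<le> M"
    "\<And>x y. x \<in> ball 0 1 \<Longrightarrow> y \<in> ball 0 1 \<Longrightarrow> \<bar>\<psi> x - \<psi> y\<bar> \<le> \<Lambda> * norm (x - y)"
    "\<And>x y z. x \<in> ball 0 1 \<Longrightarrow> y \<in> ball 0 1 \<Longrightarrow> z \<in> ball 0 1 \<Longrightarrow>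
       \<psi> y + \<psi> z - 2 * \<psi> x \<le> \<Lambda> * norm ((y - x) + (z - x)) + L * ((norm (y - x))\<^sup>2 + (norm (z - x))\<^sup>2)"
proof -
  let ?B = "ball (0::'a) 1"
  obtain D :: "'a \<Rightarrow> 'a \<Rightarrow>\<^sub>L real" and L
    where D: "\<And>x. x \<in> ?B \<Longrightarrow> (\<psi> has_derivative blinfun_apply (D x)) (at x)"
      and L: "L-lipschitz_on (closure ?B) D"
    using assms unfolding C11_closure_def by blast
  have L0: "0 \<le> L" using L by (rule lipschitz_on_nonneg)
  have LB: "norm (D x - D y) \<le> L * norm (x - y)" if "x \<in> ?B" "y \<in> ?B" for x y
    using lipschitz_onD[OF L, of x y] that closure_subset[of ?B] by (auto simp: dist_norm)
  define \<Lambda> where "\<Lambda> = norm (D 0) + L"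
  have \<Lambda>0: "0 \<le> \<Lambda>" using L0 by (simp add: \<Lambda>_def)
  have D\<Lambda>: "norm (D x) \<le> \<Lambda>" if x: "x \<in> ?B" for x
  proof -
    have "norm (D x) \<le> norm (D 0) + norm (D x - D 0)" using norm_triangle_ineq[of "D 0" "D x - D 0"] by simp
    also have "norm (D x - D 0) \<le> L * norm x" using LB[of x 0] x by simp
    also have "L * norm x \<le> L * 1" using x L0 by (intro mult_left_mono) auto
    finally show ?thesis by (simp add: \<Lambda>_def)
  qed
  have lip: "\<bar>\<psi> x - \<psi> y\<bar> \<le> \<Lambda> * norm (x - y)" if "x \<in> ?B" "y \<in> ?B" for x y
  proof -
    have "norm (\<psi> x - \<psi> y) \<le> \<Lambda> * norm (x - y)"
      by (rule differentiable_bound[where S = ?B, OF convex_ball, where f' = "\<lambda>x. blinfun_apply (D x)"])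
         (use D D\<Lambda> that in \<open>auto simp flip: norm_blinfun.rep_eq intro: has_derivative_at_withinI\<close>)
    then show ?thesis by simp
  qed
  have taylor: "\<bar>\<psi> y - \<psi> x - D x (y - x)\<bar> \<le> L * (norm (y - x))\<^sup>2" if x: "x \<in> ?B" and y: "y \<in> ?B" for x y
  proof -
    have seg: "closed_segment x y \<subseteq> ?B" using x y by (simp add: closed_segment_subset)
    have "norm (\<psi> y - \<psi> x - D x (y - x)) \<le> norm (y - x) * (L * norm (y - x))"
    proof (rule differentiable_bound_linearization[of x y "closed_segment x y" \<psi> "\<lambda>x. blinfun_apply (D x)" x])
      show "x + t *\<^sub>R (y - x) \<in> closed_segment x y" if "t \<in> {0..1}" for t
        using that by (auto simp: in_segment algebra_simps intro!: exI[of _ t])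
      show "(\<psi> has_derivative blinfun_apply (D u)) (at u within closed_segment x y)" if "u \<in> closed_segment x y" for u
        using D seg that by (blast intro: has_derivative_at_withinI)
      show "onorm (blinfun_apply (D u) - blinfun_apply (D x)) \<le> L * norm (y - x)" if "u \<in> closed_segment x y" for u
      proof -
        have "onorm (blinfun_apply (D u) - blinfun_apply (D x)) = norm (D u - D x)"
          by (simp add: norm_blinfun.rep_eq fun_diff_def blinfun.diff_left[abs_def])
        also have "\<dots> \<le> L * norm (u - x)" using LB seg that x by blast
        also have "\<dots> \<le> L * norm (y - x)"
          using segment_bound1[OF that] L0 by (intro mult_left_mono) (auto simp: norm_minus_commute)
        finally show ?thesis .
      qed
    qed auto
    then show ?thesis by (simp add: power2_eq_square mult_ac)
  qed
  show ?thesis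
  proof (rule that[of "\<bar>\<psi> 0\<bar> + \<Lambda>" \<Lambda> L])
    show "\<bar>\<psi> x\<bar> \<le> \<bar>\<psi> 0\<bar> + \<Lambda>" if "x \<in> ?B" for x
    proof -
      have "\<Lambda> * norm x \<le> \<Lambda> * 1" using that \<Lambda>0 by (intro mult_left_mono) auto
      moreover have "\<bar>\<psi> x - \<psi> 0\<bar> \<le> \<Lambda> * norm x" using lip[of x 0] that by simp
      ultimately show ?thesis by linarith
    qed
    show "\<psi> y + \<psi> z - 2 * \<psi> x \<le> \<Lambda> * norm ((y - x) + (z - x)) + L * ((norm (y - x))\<^sup>2 + (norm (z - x))\<^sup>2)"
      if x: "x \<in> ?B" and y: "y \<in> ?B" and z: "z \<in> ?B" for x y z
    proof -
      have "D x (y - x) + D x (z - x) = D x ((y - x) + (z - x))" by (simp add: blinfun.add_right)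
      also have "\<dots> \<le> norm (D x) * norm ((y - x) + (z - x))"
        using norm_blinfun[of "D x" "(y - x) + (z - x)"] by simp
      also have "\<dots> \<le> \<Lambda> * norm ((y - x) + (z - x))" by (intro mult_right_mono D\<Lambda> x) simp
      finally show ?thesis
        using taylor[OF x y] taylor[OF x z] by (simp add: distrib_left abs_le_iff)
    qed
  qed (use L0 \<Lambda>0 lip in auto)
qed

lemma cont_psh_const: "cont_psh U (\<lambda>_. c)"
  by (simp add: cont_psh_def)

lemma cont_psh_subset: "cont_psh V u \<Longrightarrow> U \<subseteq> V \<Longrightarrow> cont_psh U u"
  unfolding cont_psh_def by (meson continuous_on_subset subsetD)

lemma cont_psh_average_minus_const:
  fixes u w :: "complex ^ 'n \<Rightarrow> real"
  assumes u: "cont_psh U u" and w: "cont_psh U w"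
  shows "cont_psh U (\<lambda>z. (1/2) * (u z + w z) - c)"
  unfolding cont_psh_def
proof (intro conjI allI impI)
  have cu: "continuous_on U u" "continuous_on U w" using u w by (simp_all add: cont_psh_def)
  then show "continuous_on U (\<lambda>z. (1/2) * (u z + w z) - c)" by (intro continuous_intros)
  fix z v assume d: "\<forall>\<zeta>. norm \<zeta> \<le> 1 \<longrightarrow> z + \<zeta> *s v \<in> U"
  define F G where "F = (\<lambda>\<omega>. u (z + \<omega> *s v))" and "G = (\<lambda>\<omega>. w (z + \<omega> *s v))"
  have c: "continuous_on (sphere 0 1) F" "continuous_on (sphere 0 1) G"
    unfolding F_def G_def by (rule continuous_on_line[OF cu(1)], use d in simp, rule continuous_on_line[OF cu(2)], use d in simp)
  have "u z \<le> circle_avg F" "w z \<le> circle_avg G"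
    using u w d unfolding cont_psh_def F_def G_def by blast+
  then have "(1/2) * (u z + w z) - c \<le> (1/2) * (circle_avg F + circle_avg G) - circle_avg (\<lambda>_. c)"
    by simp
  also have "\<dots> = circle_avg (\<lambda>\<omega>. (1/2) * (F \<omega> + G \<omega>)) - circle_avg (\<lambda>_. c)"
    by (simp only: circle_avg_cmul circle_avg_add[OF c])
  also have "\<dots> = circle_avg (\<lambda>\<omega>. (1/2) * (F \<omega> + G \<omega>) - c)"
    by (intro circle_avg_diff[symmetric] continuous_intros c)
  finally show "(1/2) * (u z + w z) - c \<le> circle_avg (\<lambda>\<omega>. (1/2) * (u (z + \<omega> *s v) + w (z + \<omega> *s v)) - c)"
    by (simp add: F_def G_def)
qed

definition competitors :: "(complex ^ 'n \<Rightarrow> real) \<Rightarrow> (complex ^ 'n \<Rightarrow> ereal) set" where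
  "competitors \<psi> = {v \<in> PSH (ball 0 1). \<forall>x\<in>ball 0 1. v x \<le> ereal (\<psi> x)}"

text \<open>The supremum without upper semicontinuous regularization. It turns out to be continuous, and then it
coincides with the regularized envelope.\<close>
definition envelope :: "(complex ^ 'n \<Rightarrow> real) \<Rightarrow> complex ^ 'n \<Rightarrow> real" where
  "envelope \<psi> z = real_of_ereal (SUP v\<in>competitors \<psi>. v z)"

locale ball_obstacle =
  fixes \<psi> :: "complex ^ 'n \<Rightarrow> real" and M \<Lambda> L :: real
  assumes bound: "x \<in> ball 0 1 \<Longrightarrow> \<bar>\<psi> x\<bar> \<le> M"
    and lip: "x \<in> ball 0 1 \<Longrightarrow> y \<in> ball 0 1 \<Longrightarrow> \<bar>\<psi> x - \<psi> y\<bar> \<le> \<Lambda> * norm (x - y)"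
    and second_order: "x \<in> ball 0 1 \<Longrightarrow> y \<in> ball 0 1 \<Longrightarrow> z \<in> ball 0 1 \<Longrightarrow>
       \<psi> y + \<psi> z - 2 * \<psi> x \<le> \<Lambda> * norm ((y - x) + (z - x)) + L * ((norm (y - x))\<^sup>2 + (norm (z - x))\<^sup>2)"
    and \<Lambda>_nonneg: "0 \<le> \<Lambda>" and L_nonneg: "0 \<le> L"
begin

lemma M_nonneg: "0 \<le> M"
  using bound[of 0] by simp

lemma ereal_envelope:
  assumes z: "z \<in> ball 0 1"
  shows "ereal (envelope \<psi> z) = (SUP v\<in>competitors \<psi>. v z)"
    and "\<bar>envelope \<psi> z\<bar> \<le> M" and "envelope \<psi> z \<le> \<psi> z"
proof -
  have "- M \<le> \<psi> x" if "x \<in> ball 0 1" for x using bound[OF that] by simp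
  then have "(\<lambda>_. ereal (- M)) \<in> competitors \<psi>"
    by (auto simp: competitors_def intro!: cont_psh_imp_PSH cont_psh_const)
  then have 1: "ereal (- M) \<le> (SUP v\<in>competitors \<psi>. v z)"
    by (rule SUP_upper2) simp
  have 2: "(SUP v\<in>competitors \<psi>. v z) \<le> ereal (\<psi> z)"
    by (rule SUP_least) (use z in \<open>auto simp: competitors_def\<close>)
  show eq: "ereal (envelope \<psi> z) = (SUP v\<in>competitors \<psi>. v z)"
    unfolding envelope_def using 1 2 by (cases "SUP v\<in>competitors \<psi>. v z") auto
  show 3: "envelope \<psi> z \<le> \<psi> z" using 2 by (simp flip: eq)
  show "\<bar>envelope \<psi> z\<bar> \<le> M" using 1 3 bound[OF z] by (simp flip: eq add: abs_le_iff)
qed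

lemma cont_psh_le_envelope:
  assumes u: "cont_psh (ball 0 1) u" and le: "\<And>x. x \<in> ball 0 1 \<Longrightarrow> u x \<le> \<psi> x" and z: "z \<in> ball 0 1"
  shows "u z \<le> envelope \<psi> z"
proof -
  have "(\<lambda>z. ereal (u z)) \<in> competitors \<psi>"
    using cont_psh_imp_PSH[OF open_ball u] le by (simp add: competitors_def)
  then have "ereal (u z) \<le> ereal (envelope \<psi> z)"
    unfolding ereal_envelope(1)[OF z] by (rule SUP_upper)
  then show ?thesis by simp
qed

lemma borel_measurable_usc_circle:
  fixes u :: "complex ^ 'n \<Rightarrow> ereal"
  assumes U: "open U" and usc: "usc_on U u" and d: "\<And>\<zeta>. norm \<zeta> = 1 \<Longrightarrow> z + \<zeta> *s v \<in> U"
  shows "(\<lambda>t. u (z + cis t *s v)) \<in> borel_measurable borel"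
proof (rule borel_measurableI_less)
  fix y
  have "open ((\<lambda>t. z + cis t *s v) -` {x \<in> U. u x < y})"
    by (intro open_vimage open_usc_sublevel U usc continuous_intros)
  moreover have "(\<lambda>t. z + cis t *s v) -` {x \<in> U. u x < y} = {t \<in> space borel. u (z + cis t *s v) < y}"
    using d by auto
  ultimately show "{t \<in> space borel. u (z + cis t *s v) < y} \<in> sets borel" by simp
qed

text \<open>The maximum with the constant \<open>- M \<le> \<psi>\<close> keeps the new function away from \<open>- \<infinity>\<close>: the old competitor
could a priori be \<open>- \<infinity>\<close> on the whole image of the affine map.\<close>
lemma affine_shift_of_competitor:
  assumes s: "0 \<le> s" "s < 1" and h: "norm h \<le> s" and v: "v \<in> competitors \<psi>"
  shows "(\<lambda>z. max (v ((1 - s) *\<^sub>R z + h) - ereal (2 * \<Lambda> * s)) (ereal (- M))) \<in> competitors \<psi>"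
proof -
  let ?B = "ball (0 :: complex ^ 'n) 1"
  define T where "T = (\<lambda>z :: complex ^ 'n. (1 - s) *\<^sub>R z + h)"
  define c where "c = 2 * \<Lambda> * s"
  define w where "w = (\<lambda>z. max (v (T z) - ereal c) (ereal (- M)))"
  have c: "0 \<le> c" using \<Lambda>_nonneg s by (simp add: c_def)
  have vP: "v \<in> PSH ?B" and v\<psi>: "\<And>x. x \<in> ?B \<Longrightarrow> v x \<le> ereal (\<psi> x)"
    using v by (auto simp: competitors_def)
  have usc: "usc_on ?B v" using vP by (auto simp: PSH_def)
  have TB: "T z \<in> ?B" if "z \<in> ?B" for z
  proof -
    have "norm (T z) \<le> (1 - s) * norm z + s"
      using norm_triangle_ineq[of "(1 - s) *\<^sub>R z" h] s h by (simp add: T_def)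
    also have "\<dots> < (1 - s) * 1 + s" using that s by (intro add_strict_right_mono mult_strict_left_mono) auto
    finally show ?thesis by simp
  qed
  have w\<psi>: "w z \<le> ereal (\<psi> z)" if z: "z \<in> ?B" for z
  proof -
    have "norm (T z - z) \<le> 2 * s"
    proof -
      have "T z - z = h - s *\<^sub>R z" by (simp add: T_def algebra_simps)
      then have "norm (T z - z) \<le> norm h + s * norm z" using norm_triangle_ineq4[of h "s *\<^sub>R z"] s by simp
      also have "\<dots> \<le> s + s * 1" using z s h by (intro add_mono mult_left_mono) auto
      finally show ?thesis by simp
    qed
    then have "\<Lambda> * norm (T z - z) \<le> c" using mult_left_mono[OF _ \<Lambda>_nonneg] by (fastforce simp: c_def)
    then have "\<psi> (T z) - c \<le> \<psi> z" using lip[OF TB[OF z] z] by simp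
    then have "v (T z) - ereal c \<le> ereal (\<psi> z)"
      using v\<psi>[OF TB[OF z]] by (cases "v (T z)") auto
    moreover have "- M \<le> \<psi> z" using bound[OF z] by simp
    ultimately show ?thesis by (simp add: w_def)
  qed
  have "w \<in> PSH ?B"
  proof (rule PSH_I[OF open_ball])
    show "usc_on ?B w"
      unfolding usc_on_def
    proof
      fix y
      have "{x \<in> ?B. w x < y} = (if ereal (- M) < y then ?B \<inter> T -` {x \<in> ?B. v x < y + ereal c} else {})"
        using TB by (auto simp: w_def ereal_minus_less)
      moreover have "open (T -` {x \<in> ?B. v x < y + ereal c})"
        by (intro open_vimage open_usc_sublevel usc) (auto simp: T_def intro!: continuous_intros)
      ultimately have "open {x \<in> ?B. w x < y}" by auto
      then show "openin (top_of_set ?B) {x \<in> ?B. w x < y}" by (intro open_subset) auto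
    qed
    show "w z < \<infinity>" if "z \<in> ?B" for z using w\<psi>[OF that] by (auto intro: le_less_trans)
    show "w z \<noteq> - \<infinity>" for z by (auto simp: w_def max_def)
    fix z d assume d: "\<And>\<zeta>. norm \<zeta> \<le> 1 \<Longrightarrow> z + \<zeta> *s d \<in> ?B"
    have T_line: "T (z + \<zeta> *s d) = T z + \<zeta> *s ((1 - s) *\<^sub>R d)" for \<zeta>
      by (simp add: T_def vec_eq_iff scaleR_right_distrib)
    have Td: "T z + \<zeta> *s ((1 - s) *\<^sub>R d) \<in> ?B" if "norm \<zeta> \<le> 1" for \<zeta>
      using TB[OF d[OF that]] by (simp add: T_line)
    have "ereal (- M) \<le> circle_mean (\<lambda>\<zeta>. w (z + \<zeta> *s d)) 0 1"
    proof -
      have "ereal (- M) = circle_mean (\<lambda>\<zeta>. ereal (- M)) 0 1"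
        by (subst circle_mean_real) auto
      also have "\<dots> \<le> circle_mean (\<lambda>\<zeta>. w (z + \<zeta> *s d)) 0 1"
        by (rule circle_mean_mono) (simp add: w_def)
      finally show ?thesis .
    qed
    moreover have "v (T z) - ereal c \<le> circle_mean (\<lambda>\<zeta>. w (z + \<zeta> *s d)) 0 1"
    proof -
      have "v (T z) - ereal c \<le> circle_mean (\<lambda>\<zeta>. v (T z + \<zeta> *s ((1 - s) *\<^sub>R d))) 0 1 - ereal c"
        by (intro ereal_minus_mono PSH_D[OF vP] Td) auto
      also have "\<dots> \<le> circle_mean (\<lambda>\<zeta>. v (T z + \<zeta> *s ((1 - s) *\<^sub>R d)) - ereal c) 0 1"
      proof (rule circle_mean_minus_const_ge[OF _ _ c])
        show "(\<lambda>t. v (T z + (0 + of_real 1 * cis t) *s ((1 - s) *\<^sub>R d))) \<in> borel_measurable borel"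
          using borel_measurable_usc_circle[OF open_ball usc, of "T z" "(1 - s) *\<^sub>R d"] Td by simp
        fix t
        have "T z + (0 + of_real 1 * cis t) *s ((1 - s) *\<^sub>R d) \<in> ?B" by (rule Td) simp
        from v\<psi>[OF this] bound[OF this]
        show "v (T z + (0 + of_real 1 * cis t) *s ((1 - s) *\<^sub>R d)) \<le> ereal M"
          by (auto simp: abs_le_iff intro: order_trans)
      qed
      also have "\<dots> \<le> circle_mean (\<lambda>\<zeta>. w (z + \<zeta> *s d)) 0 1"
        by (rule circle_mean_mono) (simp add: w_def T_line)
      finally show ?thesis .
    qed
    ultimately show "w z \<le> circle_mean (\<lambda>\<zeta>. w (z + \<zeta> *s d)) 0 1" by (simp add: w_def)
  qed
  then have "w \<in> competitors \<psi>" using w\<psi> by (simp add: competitors_def)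
  then show ?thesis by (simp add: w_def T_def c_def)
qed

lemma envelope_at_affine_image:
  assumes s: "0 \<le> s" "s < 1" and h: "norm h \<le> s"
    and z: "z \<in> ball 0 1" "(1 - s) *\<^sub>R z + h \<in> ball 0 1"
  shows "envelope \<psi> ((1 - s) *\<^sub>R z + h) \<le> envelope \<psi> z + 2 * \<Lambda> * s"
proof -
  have "(SUP v\<in>competitors \<psi>. v ((1 - s) *\<^sub>R z + h)) \<le> ereal (envelope \<psi> z + 2 * \<Lambda> * s)"
  proof (rule SUP_least)
    fix v assume v: "v \<in> competitors \<psi>"
    have "v ((1 - s) *\<^sub>R z + h) - ereal (2 * \<Lambda> * s) \<le> max (v ((1 - s) *\<^sub>R z + h) - ereal (2 * \<Lambda> * s)) (ereal (- M))"
      by simp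
    also have "\<dots> \<le> ereal (envelope \<psi> z)"
      unfolding ereal_envelope(1)[OF z(1)]
      using affine_shift_of_competitor[OF s h v] by (rule SUP_upper2) simp_all
    finally show "v ((1 - s) *\<^sub>R z + h) \<le> ereal (envelope \<psi> z + 2 * \<Lambda> * s)"
      by (simp add: ereal_minus_le)
  qed
  then show ?thesis by (simp flip: ereal_envelope(1)[OF z(2)])
qed

text \<open>The affine map with \<open>s = |x - y| / (1 - \<rho>)\<close> and \<open>h = x - y + s y\<close> sends \<open>y\<close> to \<open>x\<close>, and \<open>|h| \<le> s\<close>. If
\<open>s \<ge> 1\<close> it is not available, but then the bound by \<open>2 M\<close> suffices.\<close>
lemma envelope_lipschitz:
  assumes \<rho>: "\<rho> < 1" and x: "norm x \<le> \<rho>" and y: "norm y \<le> \<rho>"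
  shows "\<bar>envelope \<psi> x - envelope \<psi> y\<bar> \<le> (2 * \<Lambda> + 2 * M) / (1 - \<rho>) * norm (x - y)"
proof -
  define s where "s = norm (x - y) / (1 - \<rho>)"
  have s0: "0 \<le> s" using \<rho> by (simp add: s_def)
  have B: "x \<in> ball 0 1" "y \<in> ball 0 1" using x y \<rho> by auto
  have M0: "0 \<le> M" using bound[OF B(1)] by simp
  have "\<bar>envelope \<psi> x - envelope \<psi> y\<bar> \<le> (2 * \<Lambda> + 2 * M) * s"
  proof (cases "s < 1")
    case True
    have half: "envelope \<psi> x \<le> envelope \<psi> y + 2 * \<Lambda> * s"
      if "norm x \<le> \<rho>" "norm y \<le> \<rho>" "s = norm (x - y) / (1 - \<rho>)" for x y :: "complex ^ 'n"
    proof -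
      define h where "h = (x - y) + s *\<^sub>R y"
      have "norm h \<le> norm (x - y) + s * norm y"
        using norm_triangle_ineq[of "x - y" "s *\<^sub>R y"] s0 by (simp add: h_def)
      also have "\<dots> \<le> s * (1 - \<rho>) + s * \<rho>"
        using that s0 \<rho> by (intro add_mono mult_left_mono) auto
      finally have h: "norm h \<le> s" by (simp add: algebra_simps)
      have "(1 - s) *\<^sub>R y + h = x" by (simp add: h_def algebra_simps)
      then show ?thesis
        using envelope_at_affine_image[OF s0 True h, of y] that \<rho> by simp
    qed
    have "\<bar>envelope \<psi> x - envelope \<psi> y\<bar> \<le> 2 * \<Lambda> * s"
      using half[OF x y s_def] half[OF y x] by (simp add: s_def norm_minus_commute abs_le_iff)
    also have "\<dots> \<le> (2 * \<Lambda> + 2 * M) * s" using M0 s0 by (intro mult_right_mono) auto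
    finally show ?thesis .
  next
    case False
    have "\<bar>envelope \<psi> x - envelope \<psi> y\<bar> \<le> 2 * M"
      using ereal_envelope(2)[OF B(1)] ereal_envelope(2)[OF B(2)] by simp
    also have "\<dots> \<le> (2 * \<Lambda> + 2 * M) * 1" using \<Lambda>_nonneg by simp
    also have "\<dots> \<le> (2 * \<Lambda> + 2 * M) * s" using False M0 \<Lambda>_nonneg by (intro mult_left_mono) auto
    finally show ?thesis .
  qed
  then show ?thesis by (simp add: s_def)
qed

lemma continuous_on_envelope:
  shows "continuous_on (ball 0 1) (envelope \<psi>)"
proof (rule continuous_at_imp_continuous_on, rule ballI)
  fix z :: "complex ^ 'n" assume z: "z \<in> ball 0 1"
  define \<rho> where "\<rho> = (1 + norm z) / 2"
  have \<rho>: "norm z < \<rho>" "\<rho> < 1" using z by (auto simp: \<rho>_def field_simps)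
  have M0: "0 \<le> M" using bound[OF z] by simp
  have "((2 * \<Lambda> + 2 * M) / (1 - \<rho>))-lipschitz_on (ball 0 \<rho>) (envelope \<psi>)"
    using envelope_lipschitz[OF \<rho>(2)] \<rho>(2) M0 \<Lambda>_nonneg
    by (intro lipschitz_onI) (auto simp: dist_norm dist_real_def)
  then have "continuous_on (ball 0 \<rho>) (envelope \<psi>)" by (rule lipschitz_on_continuous_on)
  then show "isCont (envelope \<psi>) z" using \<rho>(1) by (simp add: continuous_on_eq_continuous_at)
qed

text \<open>Each competitor is below its circle mean, which is below the circle average of the supremum.\<close>
lemma cont_psh_envelope:
  assumes cont: "continuous_on (ball 0 1) (envelope \<psi>)"
  shows "cont_psh (ball 0 1) (envelope \<psi>)"
  unfolding cont_psh_def
proof (intro conjI allI impI cont)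
  fix z v :: "complex ^ 'n" assume d: "\<forall>\<zeta>. norm \<zeta> \<le> 1 \<longrightarrow> z + \<zeta> *s v \<in> ball 0 1"
  have z: "z \<in> ball 0 1" using d[rule_format, of 0] by simp
  have "(SUP w\<in>competitors \<psi>. w z) \<le> ereal (circle_avg (\<lambda>\<omega>. envelope \<psi> (z + \<omega> *s v)))"
  proof (rule SUP_least)
    fix w assume w: "w \<in> competitors \<psi>"
    have "w z \<le> circle_mean (\<lambda>\<zeta>. w (z + \<zeta> *s v)) 0 1"
      by (rule PSH_D) (use w d in \<open>auto simp: competitors_def\<close>)
    also have "\<dots> \<le> circle_mean (\<lambda>\<zeta>. ereal (envelope \<psi> (z + \<zeta> *s v))) 0 1"
    proof (rule circle_mean_mono)
      fix \<zeta> :: complex assume "norm (\<zeta> - 0) = \<bar>1\<bar>"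
      then have "z + \<zeta> *s v \<in> ball 0 1" using d by simp
      then show "w (z + \<zeta> *s v) \<le> ereal (envelope \<psi> (z + \<zeta> *s v))"
        by (subst ereal_envelope(1)) (auto intro: SUP_upper w)
    qed
    also have "\<dots> = ereal (circle_avg (\<lambda>\<omega>. envelope \<psi> (z + \<omega> *s v)))"
      using circle_mean_real[of "\<lambda>\<zeta>. envelope \<psi> (z + \<zeta> *s v)" 0 1]
        continuous_on_line[OF cont, of "sphere 0 1" z v] d by simp
    finally show "w z \<le> ereal (circle_avg (\<lambda>\<omega>. envelope \<psi> (z + \<omega> *s v)))" .
  qed
  then show "envelope \<psi> z \<le> circle_avg (\<lambda>\<omega>. envelope \<psi> (z + \<omega> *s v))"
    by (simp flip: ereal_envelope(1)[OF z])
qed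

lemma psh_envelope_eq_envelope:
  assumes cont: "continuous_on (ball 0 1) (envelope \<psi>)" and z: "z \<in> ball 0 1"
  shows "psh_envelope (ball 0 1) \<psi> z = ereal (envelope \<psi> z)"
proof -
  let ?F = "inf (nhds z) (principal (ball (0 :: complex ^ 'n) 1))"
  have F: "?F = nhds z"
    using eventually_nhds_in_open[OF open_ball z] by (intro inf_absorb1) (simp add: le_principal)
  have "isCont (envelope \<psi>) z"
    using cont z by (simp add: continuous_on_eq_continuous_at)
  then have "(envelope \<psi> \<longlongrightarrow> envelope \<psi> z) (nhds z)"
    by (simp add: isCont_def tendsto_at_iff_tendsto_nhds)
  then have "((\<lambda>x. ereal (envelope \<psi> x)) \<longlongrightarrow> ereal (envelope \<psi> z)) (nhds z)" by simp
  moreover have "\<forall>\<^sub>F x in nhds z. ereal (envelope \<psi> x) = (SUP v\<in>competitors \<psi>. v x)"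
    using eventually_nhds_in_open[OF open_ball z] by eventually_elim (rule ereal_envelope(1))
  ultimately have "((\<lambda>x. SUP v\<in>competitors \<psi>. v x) \<longlongrightarrow> ereal (envelope \<psi> z)) (nhds z)"
    by (rule Lim_transform_eventually)
  then have "Limsup (nhds z) (\<lambda>x. SUP v\<in>competitors \<psi>. v x) = ereal (envelope \<psi> z)"
    by (intro lim_imp_Limsup) auto
  then show ?thesis
    unfolding psh_envelope_def usc_regularization_def F competitors_def .
qed


subsection \<open>Second differences of the envelope\<close>

text \<open>The average of the envelope over the two images, lowered by a multiple of \<open>|a|^2\<close>, is a competitor.\<close>
lemma envelope_ball_map_second_difference:
  assumes a: "norm a \<le> 1/2" and z: "z \<in> ball 0 1"
  shows "envelope \<psi> (ball_map a z) + envelope \<psi> (ball_map (- a) z)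
      \<le> 2 * envelope \<psi> z + (32 * \<Lambda> + 128 * L) * (norm a)\<^sup>2"
proof -
  define c where "c = (16 * \<Lambda> + 64 * L) * (norm a)\<^sup>2"
  define u where "u = (\<lambda>z. (1/2) * (envelope \<psi> (ball_map a z) + envelope \<psi> (ball_map (- a) z)) - c)"
  have a': "norm (- a) \<le> 1/2" using a by simp
  have "cont_psh (ball 0 1) u"
    unfolding u_def
    by (intro cont_psh_average_minus_const cont_psh_compose_ball_map cont_psh_envelope continuous_on_envelope a a')
  moreover have "u x \<le> \<psi> x" if x: "x \<in> ball 0 1" for x
  proof -
    let ?p = "ball_map a x" and ?q = "ball_map (- a) x"
    have nx: "norm x \<le> 1" "norm x < 1" using x by auto
    have pq: "?p \<in> ball 0 1" "?q \<in> ball 0 1"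
      using ball_map_in_ball[OF a nx(2)] ball_map_in_ball[OF a' nx(2)] by auto
    have "\<psi> ?p + \<psi> ?q - 2 * \<psi> x \<le> \<Lambda> * norm ((?p - x) + (?q - x)) + L * ((norm (?p - x))\<^sup>2 + (norm (?q - x))\<^sup>2)"
      by (rule second_order[OF x pq])
    also have "\<dots> \<le> \<Lambda> * (32 * (norm a)\<^sup>2) + L * ((8 * norm a)\<^sup>2 + (8 * norm a)\<^sup>2)"
    proof (intro add_mono mult_left_mono \<Lambda>_nonneg L_nonneg power_mono)
      show "norm ((?p - x) + (?q - x)) \<le> 32 * (norm a)\<^sup>2" by (rule ball_map_symmetric_second_order[OF a nx(1)])
      show "norm (?p - x) \<le> 8 * norm a" by (rule ball_map_expansion(1)[OF a nx(1)])
      show "norm (?q - x) \<le> 8 * norm a" using ball_map_expansion(1)[OF a' nx(1)] by simp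
    qed auto
    also have "\<dots> = 2 * c" by (simp add: c_def power_mult_distrib algebra_simps)
    finally show ?thesis
      using ereal_envelope(3)[OF pq(1)] ereal_envelope(3)[OF pq(2)] by (simp add: u_def field_simps)
  qed
  ultimately have "u z \<le> envelope \<psi> z" using z by (rule cont_psh_le_envelope)
  then show ?thesis by (simp add: u_def c_def field_simps)
qed

text \<open>For \<open>a = h + \<mu> z\<close> the equation says \<open>\<mu> = herm z h + |z|^2 cnj \<mu>\<close>; together with its conjugate this
is a linear system for \<open>\<mu>\<close> and \<open>cnj \<mu>\<close> with determinant \<open>1 - |z|^4\<close>.\<close>
lemma infinitesimal_translation_exists:
  fixes z h :: "complex ^ 'm"
  assumes \<rho>: "0 < \<rho>" "\<rho> < 1" and z: "norm z \<le> \<rho>"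
  obtains a where "a - herm z a *s z = h" "norm a \<le> norm h / (1 - \<rho>)"
proof -
  define s where "s = (norm z)\<^sup>2"
  define k where "k = herm z h"
  define \<mu> where "\<mu> = (k + of_real s * cnj k) / of_real (1 - s\<^sup>2)"
  have s0: "0 \<le> s" by (simp add: s_def)
  have "s \<le> \<rho> * \<rho>" using z \<rho> unfolding s_def power2_eq_square by (intro mult_mono) auto
  also have "\<dots> \<le> \<rho> * 1" using \<rho> by (intro mult_left_mono) auto
  finally have s: "s \<le> \<rho>" by simp
  then have s1: "s < 1" using \<rho> by simp
  have s2: "0 < 1 - s\<^sup>2" using s0 s1 by (simp add: power_less_one_iff)
  have lam: "k + cnj \<mu> * of_real s = \<mu>"
  proof -
    have nz: "complex_of_real (1 - s\<^sup>2) \<noteq> 0" unfolding of_real_eq_0_iff using s2 by linarith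
    have 1: "\<mu> * of_real (1 - s\<^sup>2) = k + of_real s * cnj k" using nz by (simp add: \<mu>_def)
    have 2: "cnj \<mu> * of_real (1 - s\<^sup>2) = cnj k + of_real s * k" using nz by (simp add: \<mu>_def)
    have T: "complex_of_real (1 - s\<^sup>2) = 1 - of_real s * of_real s" by (simp add: power2_eq_square)
    have "(k + cnj \<mu> * of_real s) * of_real (1 - s\<^sup>2) =
        k * of_real (1 - s\<^sup>2) + (cnj \<mu> * of_real (1 - s\<^sup>2)) * of_real s"
      by (simp only: distrib_right mult.assoc mult.commute mult.left_commute)
    also have "\<dots> = k * (1 - of_real s * of_real s) + (cnj k + of_real s * k) * of_real s"
      unfolding 2 unfolding T by (rule refl)
    also have "\<dots> = k + of_real s * cnj k" by (simp add: algebra_simps)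
    finally have "(k + cnj \<mu> * of_real s) * of_real (1 - s\<^sup>2) = \<mu> * of_real (1 - s\<^sup>2)"
      by (simp only: 1)
    then show ?thesis using nz by simp
  qed
  define a where "a = h + \<mu> *s z"
  have "herm z a = \<mu>"
    using lam by (simp add: a_def herm_add_right herm_smult_right herm_self k_def s_def)
  then have 1: "a - herm z a *s z = h" by (simp add: a_def)
  have "norm \<mu> \<le> norm h / (1 - \<rho>)"
  proof -
    have "norm (k + of_real s * cnj k) \<le> norm k + s * norm k"
      using norm_triangle_ineq[of k "of_real s * cnj k"] s0 by (simp add: norm_mult)
    moreover have "norm \<mu> = norm (k + of_real s * cnj k) / (1 - s\<^sup>2)"
      unfolding \<mu>_def norm_divide norm_of_real using s2 by simp
    ultimately have "norm \<mu> \<le> (norm k + s * norm k) / (1 - s\<^sup>2)"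
      using s2 by (simp add: divide_right_mono)
    also have "\<dots> = norm k / (1 - s)"
    proof -
      have "1 - s\<^sup>2 = (1 - s) * (1 + s)" by (simp add: power2_eq_square algebra_simps)
      moreover have "norm k + s * norm k = norm k * (1 + s)" by (simp add: algebra_simps)
      ultimately show ?thesis using s0 by simp
    qed
    also have "\<dots> \<le> norm h / (1 - \<rho>)"
    proof (rule frac_le)
      show "norm k \<le> norm h"
        using norm_herm_le[of z h] mult_right_mono[of "norm z" 1 "norm h"] z \<rho> by (simp add: k_def)
    qed (use s \<rho> in auto)
    finally show ?thesis .
  qed
  then have "norm \<mu> * norm z \<le> norm h / (1 - \<rho>) * \<rho>"
    using z \<rho> by (intro mult_mono) auto
  then have "norm a \<le> norm h + norm h / (1 - \<rho>) * \<rho>"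
    using norm_triangle_ineq[of h "\<mu> *s z"] by (simp add: a_def norm_vector_smult)
  also have "\<dots> = norm h / (1 - \<rho>)" using \<rho> by (simp add: field_simps)
  finally have 2: "norm a \<le> norm h / (1 - \<rho>)" .
  show ?thesis by (rule that[OF 1 2])
qed

text \<open>Choosing \<open>a\<close> with \<open>h = a - herm z a *s z\<close>, the points \<open>z + h\<close> and \<open>z - h\<close> differ from the images of
\<open>z\<close> under the ball maps by \<open>O(|a|^2)\<close>, which the Lipschitz bound of the envelope turns into an error of
the same order. The restriction on \<open>h\<close> keeps all four points in the ball of radius \<open>(1 + \<rho>) / 2\<close>.\<close>
lemma envelope_second_difference_upper_local:
  assumes \<rho>: "0 < \<rho>" "\<rho> < 1"
  obtains A where "0 \<le> A" "\<And>z h. norm z \<le> \<rho> \<Longrightarrow> norm h \<le> (1 - \<rho>)\<^sup>2 / 16 \<Longrightarrow>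
      envelope \<psi> (z + h) + envelope \<psi> (z - h) - 2 * envelope \<psi> z \<le> A * (norm h)\<^sup>2"
proof -
  define \<rho>' where "\<rho>' = (1 + \<rho>) / 2"
  define K where "K = 32 * \<Lambda> + 128 * L"
  define \<Lambda>' where "\<Lambda>' = (2 * \<Lambda> + 2 * M) / (1 - \<rho>')"
  define A where "A = (K + 32 * \<Lambda>') / (1 - \<rho>)\<^sup>2"
  have \<rho>': "\<rho>' < 1" using \<rho> by (simp add: \<rho>'_def)
  have nonneg: "0 \<le> K" "0 \<le> \<Lambda>'"
    using \<Lambda>_nonneg L_nonneg M_nonneg \<rho>' by (simp_all add: K_def \<Lambda>'_def)
  have "envelope \<psi> (z + h) + envelope \<psi> (z - h) - 2 * envelope \<psi> z \<le> A * (norm h)\<^sup>2"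
    if z: "norm z \<le> \<rho>" and h: "norm h \<le> (1 - \<rho>)\<^sup>2 / 16" for z h
  proof -
    obtain a where a1: "a - herm z a *s z = h" and a2: "norm a \<le> norm h / (1 - \<rho>)"
      using infinitesimal_translation_exists[OF \<rho> z, of h] by blast
    have "norm h / (1 - \<rho>) \<le> (1 - \<rho>)\<^sup>2 / 16 / (1 - \<rho>)"
      using h \<rho> by (intro divide_right_mono) auto
    also have "\<dots> = (1 - \<rho>) / 16"
    proof -
      have "e\<^sup>2 / 16 / e = e / 16" if "0 < e" for e :: real using that by (simp add: power2_eq_square)
      from this[of "1 - \<rho>"] show ?thesis using \<rho>(2) by simp
    qed
    finally have a3: "norm a \<le> (1 - \<rho>) / 16" by (rule order_trans[OF a2])
    then have a: "norm a \<le> 1/2" "norm (- a) \<le> 1/2" using \<rho> by auto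
    have z1: "norm z \<le> 1" and zB: "z \<in> ball 0 1" using z \<rho> by auto
    have "(1 - \<rho>)\<^sup>2 \<le> (1 - \<rho>) * 1" unfolding power2_eq_square using \<rho> by (intro mult_left_mono) auto
    then have h': "norm h \<le> (1 - \<rho>) / 16" using h by simp
    have near: "\<bar>envelope \<psi> p - envelope \<psi> q\<bar> \<le> \<Lambda>' * (16 * (norm a)\<^sup>2)"
      if "norm p \<le> \<rho>'" "norm q \<le> \<rho>'" "norm (p - q) \<le> 16 * (norm a)\<^sup>2" for p q
      using envelope_lipschitz[OF \<rho>' that(1,2)] mult_left_mono[OF that(3) nonneg(2)]
      by (simp add: \<Lambda>'_def)
    have in\<rho>: "norm (z + h) \<le> \<rho>'" "norm (z - h) \<le> \<rho>'"
      using norm_triangle_ineq[of z h] norm_triangle_ineq4[of z h] z h' \<rho> by (auto simp: \<rho>'_def field_simps)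
    have "norm (ball_map a z) \<le> norm z + norm (ball_map a z - z)"
      "norm (ball_map (- a) z) \<le> norm z + norm (ball_map (- a) z - z)"
      using norm_triangle_ineq[of z "ball_map a z - z"] norm_triangle_ineq[of z "ball_map (- a) z - z"] by simp_all
    then have im\<rho>: "norm (ball_map a z) \<le> \<rho>'" "norm (ball_map (- a) z) \<le> \<rho>'"
      using ball_map_expansion(1)[OF a(1) z1] ball_map_expansion(1)[OF a(2) z1] a3 z
      by (auto simp: \<rho>'_def field_simps)
    have e: "z + a - herm z a *s z = z + h" "z + (- a) - herm z (- a) *s z = z - h"
      using a1 by (auto simp: herm_minus_right vector_smult_lneg algebra_simps)
    have "norm (ball_map a z - (z + h)) \<le> 16 * (norm a)\<^sup>2" "norm (ball_map (- a) z - (z - h)) \<le> 16 * (norm a)\<^sup>2"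
      using ball_map_expansion(2)[OF a(1) z1, unfolded e(1)] ball_map_expansion(2)[OF a(2) z1, unfolded e(2)]
      by simp_all
    then have "envelope \<psi> (z + h) \<le> envelope \<psi> (ball_map a z) + \<Lambda>' * (16 * (norm a)\<^sup>2)"
      "envelope \<psi> (z - h) \<le> envelope \<psi> (ball_map (- a) z) + \<Lambda>' * (16 * (norm a)\<^sup>2)"
      using near[OF im\<rho>(1) in\<rho>(1)] near[OF im\<rho>(2) in\<rho>(2)] by (auto simp: abs_le_iff)
    then have "envelope \<psi> (z + h) + envelope \<psi> (z - h) - 2 * envelope \<psi> z \<le> (K + 32 * \<Lambda>') * (norm a)\<^sup>2"
      using envelope_ball_map_second_difference[OF a(1) zB] by (simp add: K_def algebra_simps)
    also have "\<dots> \<le> (K + 32 * \<Lambda>') * (norm h / (1 - \<rho>))\<^sup>2"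
      using nonneg a2 by (intro mult_left_mono power_mono) auto
    also have "\<dots> = A * (norm h)\<^sup>2" by (simp add: A_def power_divide)
    finally show ?thesis .
  qed
  moreover have "0 \<le> A" using nonneg by (simp add: A_def)
  ultimately show ?thesis using that by blast
qed

text \<open>For points that are not close, boundedness of the envelope is enough.\<close>
lemma envelope_second_difference_trivial:
  assumes "x \<in> ball 0 1" "y \<in> ball 0 1" "0 < \<delta>" "\<delta> \<le> norm (x - y)"
  shows "\<bar>envelope \<psi> x + envelope \<psi> y - 2 * envelope \<psi> (midpoint x y)\<bar> \<le> 4 * M / \<delta>\<^sup>2 * (norm (x - y))\<^sup>2"
proof -
  have m: "midpoint x y \<in> ball 0 1"
    using convexD_alt[OF convex_ball assms(1,2), of "1/2"] by (simp add: midpoint_def algebra_simps)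
  have "\<bar>envelope \<psi> x + envelope \<psi> y - 2 * envelope \<psi> (midpoint x y)\<bar> \<le> 4 * M * 1"
    using ereal_envelope(2)[OF assms(1)] ereal_envelope(2)[OF assms(2)] ereal_envelope(2)[OF m] by linarith
  also have "\<dots> \<le> 4 * M * ((norm (x - y))\<^sup>2 / \<delta>\<^sup>2)"
    using assms(3,4) M_nonneg by (intro mult_left_mono) (auto intro: power_mono)
  finally show ?thesis by simp
qed

lemma midpoint_plus_minus:
  fixes x y :: "'a::real_vector"
  defines "h \<equiv> (1/2) *\<^sub>R (x - y)"
  shows "midpoint x y + h = x" "midpoint x y - h = y"
proof -
  have "midpoint x y + h = (1/2) *\<^sub>R (x + x)" "midpoint x y - h = (1/2) *\<^sub>R (y + y)"
    unfolding midpoint_def h_def scaleR_add_right scaleR_diff_right by simp_all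
  then show "midpoint x y + h = x" "midpoint x y - h = y" by (simp_all only: scaleR_half_double)
qed

lemma midpoint_in_ball: "x \<in> ball 0 \<rho> \<Longrightarrow> y \<in> ball 0 \<rho> \<Longrightarrow> midpoint x y \<in> ball (0::'a::real_normed_vector) \<rho>"
  using convexD_alt[OF convex_ball, of x 0 \<rho> y "1/2"] by (simp add: midpoint_def algebra_simps)

lemma envelope_second_difference_upper:
  assumes \<rho>: "0 < \<rho>" "\<rho> < 1"
  obtains A where "0 \<le> A" "\<And>x y. x \<in> ball 0 \<rho> \<Longrightarrow> y \<in> ball 0 \<rho> \<Longrightarrow>
      envelope \<psi> x + envelope \<psi> y - 2 * envelope \<psi> (midpoint x y) \<le> A * (norm (x - y))\<^sup>2"
proof -
  obtain A where A: "0 \<le> A" and small: "\<And>z h. norm z \<le> \<rho> \<Longrightarrow> norm h \<le> (1 - \<rho>)\<^sup>2 / 16 \<Longrightarrow>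
      envelope \<psi> (z + h) + envelope \<psi> (z - h) - 2 * envelope \<psi> z \<le> A * (norm h)\<^sup>2"
    using envelope_second_difference_upper_local[OF \<rho>] by blast
  define \<delta> where "\<delta> = (1 - \<rho>)\<^sup>2 / 8"
  have \<delta>: "0 < \<delta>" using \<rho> by (simp add: \<delta>_def)
  show ?thesis
  proof (rule that[of "A + 4 * M / \<delta>\<^sup>2"])
    show "0 \<le> A + 4 * M / \<delta>\<^sup>2" using A M_nonneg by simp
    fix x y :: "complex ^ 'n" assume x: "x \<in> ball 0 \<rho>" and y: "y \<in> ball 0 \<rho>"
    let ?n = "(norm (x - y))\<^sup>2"
    have "envelope \<psi> x + envelope \<psi> y - 2 * envelope \<psi> (midpoint x y) \<le> A * ?n
       \<or> envelope \<psi> x + envelope \<psi> y - 2 * envelope \<psi> (midpoint x y) \<le> 4 * M / \<delta>\<^sup>2 * ?n"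
    proof (cases "norm (x - y) \<le> \<delta>")
      case True
      define h where "h = (1/2) *\<^sub>R (x - y)"
      have nh: "norm h = norm (x - y) / 2" by (simp add: h_def)
      then have "norm h \<le> (1 - \<rho>)\<^sup>2 / 16" using True by (simp add: \<delta>_def)
      moreover have "norm (midpoint x y) \<le> \<rho>" using midpoint_in_ball[OF x y] by simp
      ultimately have "envelope \<psi> x + envelope \<psi> y - 2 * envelope \<psi> (midpoint x y) \<le> A * (norm h)\<^sup>2"
        using small[of "midpoint x y" h] midpoint_plus_minus[of x y] by (simp add: h_def)
      also have "\<dots> \<le> A * ?n" using A by (intro mult_left_mono power_mono) (auto simp: nh)
      finally show ?thesis by simp
    next
      case False
      have "x \<in> ball 0 1" "y \<in> ball 0 1" using x y \<rho> by auto
      from envelope_second_difference_trivial[OF this \<delta>] False show ?thesis by (simp add: abs_le_iff)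
    qed
    moreover have "0 \<le> A * ?n" "0 \<le> 4 * M / \<delta>\<^sup>2 * ?n" using A M_nonneg by simp_all
    ultimately show "envelope \<psi> x + envelope \<psi> y - 2 * envelope \<psi> (midpoint x y) \<le> (A + 4 * M / \<delta>\<^sup>2) * ?n"
      unfolding distrib_right by linarith
  qed
qed

lemma envelope_second_difference_bound:
  assumes \<rho>: "0 < \<rho>" "\<rho> < 1"
  obtains C where "0 \<le> C" "\<And>x y. x \<in> ball 0 \<rho> \<Longrightarrow> y \<in> ball 0 \<rho> \<Longrightarrow>
      \<bar>envelope \<psi> x + envelope \<psi> y - 2 * envelope \<psi> (midpoint x y)\<bar> \<le> C * (norm (x - y))\<^sup>2"
proof -
  define \<rho>' where "\<rho>' = (1 + \<rho>) / 2"
  have \<rho>': "0 < \<rho>'" "\<rho>' < 1" "\<rho> \<le> \<rho>'" using \<rho> by (auto simp: \<rho>'_def)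
  obtain A where A: "0 \<le> A" and upper: "\<And>x y. x \<in> ball 0 \<rho>' \<Longrightarrow> y \<in> ball 0 \<rho>' \<Longrightarrow>
      envelope \<psi> x + envelope \<psi> y - 2 * envelope \<psi> (midpoint x y) \<le> A * (norm (x - y))\<^sup>2"
    using envelope_second_difference_upper[OF \<rho>'(1,2)] by blast
  define \<delta> where "\<delta> = (1 - \<rho>) / 2"
  have \<delta>: "0 < \<delta>" using \<rho> by (simp add: \<delta>_def)
  have psh: "cont_psh (ball 0 \<rho>') (envelope \<psi>)"
    by (rule cont_psh_subset[OF cont_psh_envelope[OF continuous_on_envelope]]) (use \<rho>' in auto)
  show ?thesis
  proof (rule that[of "3 * A + 4 * M / \<delta>\<^sup>2"])
    show "0 \<le> 3 * A + 4 * M / \<delta>\<^sup>2" using A M_nonneg by simp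
    fix x y :: "complex ^ 'n" assume x: "x \<in> ball 0 \<rho>" and y: "y \<in> ball 0 \<rho>"
    let ?n = "(norm (x - y))\<^sup>2" and ?s = "envelope \<psi> x + envelope \<psi> y - 2 * envelope \<psi> (midpoint x y)"
    have nonneg: "0 \<le> A * ?n" "0 \<le> 4 * M / \<delta>\<^sup>2 * ?n" using A M_nonneg by simp_all
    have "?s \<le> A * ?n" by (rule upper) (use x y \<rho>' in auto)
    moreover have "- (3 * A * ?n) \<le> ?s \<or> - (4 * M / \<delta>\<^sup>2 * ?n) \<le> ?s"
    proof (cases "norm (x - y) \<le> \<delta>")
      case True
      define h where "h = (1/2) *\<^sub>R (x - y)"
      have nh: "norm h = norm (x - y) / 2" by (simp add: h_def)
      have "midpoint x y + \<zeta> *s h \<in> ball 0 \<rho>'" if "norm \<zeta> \<le> 2" for \<zeta>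
      proof -
        have "norm (\<zeta> *s h) \<le> 2 * (\<delta> / 2)"
          unfolding norm_vector_smult nh using that True by (intro mult_mono) auto
        then have "norm (midpoint x y + \<zeta> *s h) < \<rho> + \<delta>"
          using norm_triangle_ineq[of "midpoint x y" "\<zeta> *s h"] midpoint_in_ball[OF x y] by simp
        then show ?thesis by (simp add: \<rho>'_def \<delta>_def field_simps)
      qed
      from second_difference_lower_bound[OF convex_ball psh upper A this]
      have "- 12 * A * (norm h)\<^sup>2 \<le> ?s"
        using midpoint_plus_minus[of x y] by (simp add: h_def)
      then show ?thesis by (simp add: nh power_divide)
    next
      case False
      have "x \<in> ball 0 1" "y \<in> ball 0 1" using x y \<rho> by auto
      from envelope_second_difference_trivial[OF this \<delta>] False show ?thesis by (simp add: abs_le_iff)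
    qed
    ultimately show "\<bar>?s\<bar> \<le> (3 * A + 4 * M / \<delta>\<^sup>2) * ?n"
      using nonneg unfolding distrib_right abs_le_iff by linarith
  qed
qed

end

section \<open>Regularity of the envelope\<close>

theorem theorem5p6:
  fixes \<psi> :: "complex ^ 'n \<Rightarrow> real"
  assumes "C11_closure (ball 0 1) \<psi>"
  shows "(\<forall>z \<in> ball 0 1. \<bar>psh_envelope (ball 0 1) \<psi> z\<bar> \<noteq> \<infinity>) \<and>
    C11_loc (ball 0 1) (\<lambda>z. real_of_ereal (psh_envelope (ball 0 1) \<psi> z))"
proof -
  let ?B = "ball (0 :: complex ^ 'n) 1"
  obtain M \<Lambda> L where "ball_obstacle \<psi> M \<Lambda> L"
    using C11_ball_bounds[OF assms] unfolding ball_obstacle_def by metis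
  then interpret ball_obstacle \<psi> M \<Lambda> L .
  let ?f = "\<lambda>z. real_of_ereal (psh_envelope ?B \<psi> z)"
  have P: "psh_envelope ?B \<psi> z = ereal (envelope \<psi> z)" if "z \<in> ?B" for z
    by (rule psh_envelope_eq_envelope[OF continuous_on_envelope that])
  then have f: "?f z = envelope \<psi> z" if "norm z < 1" for z using that by simp
  have "C11_loc ?B ?f"
    unfolding C11_loc_def
  proof (intro allI impI; elim conjE)
    fix U :: "(complex ^ 'n) set"
    assume U: "open U" and K: "compact (closure U)" "closure U \<subseteq> ?B"
    obtain \<rho> where \<rho>: "0 < \<rho>" "\<rho> < 1" and sub: "closure U \<subseteq> cball 0 \<rho>"
    proof (cases "closure U = {}")
      case True
      then show ?thesis using that[of "1/2"] by simp
    next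
      case False
      then obtain x where x: "x \<in> closure U" "\<And>y. y \<in> closure U \<Longrightarrow> norm y \<le> norm x"
        using continuous_attains_sup[OF K(1) False continuous_on_norm_id] by auto
      have "norm x < 1" using x(1) K(2) by auto
      show ?thesis
      proof (rule that[of "(norm x + 1) / 2"])
        show "0 < (norm x + 1) / 2" by (simp add: add_nonneg_pos)
        show "(norm x + 1) / 2 < 1" using \<open>norm x < 1\<close> by simp
        show "closure U \<subseteq> cball 0 ((norm x + 1) / 2)"
        proof
          fix y assume "y \<in> closure U"
          then have "norm y \<le> norm x" by (rule x(2))
          then show "y \<in> cball 0 ((norm x + 1) / 2)" using \<open>norm x < 1\<close> by simp
        qed
      qed
    qed
    define R where "R = (1 + \<rho>) / 2"
    have R: "0 < R" "R < 1" "\<rho> < R" using \<rho> by (auto simp: R_def)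
    obtain C where C: "0 \<le> C" "\<And>x y. x \<in> ball 0 R \<Longrightarrow> y \<in> ball 0 R \<Longrightarrow>
        \<bar>envelope \<psi> x + envelope \<psi> y - 2 * envelope \<psi> (midpoint x y)\<bar> \<le> C * (norm (x - y))\<^sup>2"
      using envelope_second_difference_bound[OF R(1,2)] by blast
    obtain D N where D: "\<forall>x\<in>ball 0 R. (?f has_derivative blinfun_apply (D x)) (at x)"
      and N: "N-lipschitz_on (cball 0 \<rho>) (D :: complex ^ 'n \<Rightarrow> (complex ^ 'n) \<Rightarrow>\<^sub>L real)"
    proof -
      have "\<exists>(D :: complex ^ 'n \<Rightarrow> (complex ^ 'n) \<Rightarrow>\<^sub>L real) N.
        (\<forall>x\<in>ball 0 R. (?f has_derivative blinfun_apply (D x)) (at x)) \<and> N-lipschitz_on (cball 0 \<rho>) D"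
      proof (rule C11_from_second_differences[OF _ _ \<rho>(1) R(3) C(1)])
        fix x y :: "complex ^ 'n" assume xy: "x \<in> ball 0 R" "y \<in> ball 0 R"
        then have n: "norm x < 1" "norm y < 1" "norm (midpoint x y) < 1"
          using midpoint_in_ball[OF xy] R(2) by auto
        show "\<bar>?f x + ?f y - 2 * ?f (midpoint x y)\<bar> \<le> C * (norm (x - y))\<^sup>2"
          unfolding f[OF n(1)] f[OF n(2)] f[OF n(3)] by (rule C(2)[OF xy])
        show "\<bar>?f x - ?f y\<bar> \<le> (2 * \<Lambda> + 2 * M) / (1 - R) * norm (x - y)"
          unfolding f[OF n(1)] f[OF n(2)] by (rule envelope_lipschitz[OF R(2)]) (use xy in auto)
      qed
      then show ?thesis using that by blast
    qed
    have UR: "closure U \<subseteq> ball 0 R" using sub R(3) by auto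
    have deriv: "\<forall>x\<in>closure U. (?f has_derivative blinfun_apply (D x)) (at x)" using D UR by blast
    show "C11_closure U ?f"
      unfolding C11_closure_def
    proof (intro conjI exI)
      show "continuous_on (closure U) ?f"
        using deriv by (meson continuous_at_imp_continuous_on has_derivative_continuous)
      show "\<forall>x\<in>U. (?f has_derivative blinfun_apply (D x)) (at x)" using deriv closure_subset by blast
      show "N-lipschitz_on (closure U) D" by (rule lipschitz_on_subset[OF N sub])
    qed
  qed
  then show ?thesis using P by simp
qed

end
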